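(* Let the interferers be drawn from a Thomas cluster process with offspring variance $\sigma^2$ and a Poisson number of offspring points of intensity $\lambda'$ per parent point, considering only the interference from within a cluster centered at the reference transmitter, and let all access probabilities be equal to $p$. Then the spatially averaged joint first moment of the outage probability is $$\mathbb E_{M,\boldsymbol r}[\epsilon_1(\boldsymbol r)\,\epsilon_2(\boldsymbol r)]=2\,\mathbb E_{M,\boldsymbol r}[\epsilon_i(\boldsymbol r)]-1+\exp\left\{-\frac{2\beta}{\mathsf{SNR}}-\lambda'\left[1+\mathcal D(\sigma,\theta)\right]\right\},$$ where $$\mathcal D(\sigma,\theta)=(1-p)^2+2(1-p)p\,\mathcal V(\sigma)+p^2\,\mathcal X(\theta),$$ $$\mathcal V(\sigma)=\int_0^\infty\frac{r^\alpha}{\beta+r^\alpha}\,f_r(r\mid\nu)\,dr,\qquad f_r(r\mid\nu)=\frac{r}{\sigma^2}\exp\left(-\frac{r^2+\nu^2}{2\sigma^2}\right)\mathcal I_0\left(\frac{r\nu}{\sigma^2}\right),$$ $$\mathcal X(\theta)=\frac1{2\pi}\int_0^1\int_0^{2\pi}\frac{r^\alpha(\rho,\phi,0)}{\beta+r^\alpha(\rho,\phi,0)}\cdot\frac{r^\alpha(\rho,\phi,\theta)}{\beta+r^\alpha(\rho,\phi,\theta)}\,d\rho\,d\phi,$$ $$r(\rho,\phi,\theta)=\frac{\left\|r_0e^{\mathrm{i}\theta}+\sqrt{-2\sigma^2\log\rho}\;e^{\mathrm{i}\phi}\right\|}{r_0}.$$ Here $\rho$ and $\phi$ are integrated against the uniform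 laws on $(0,1)$ and $(0,2\pi)$, $\nu$ is the relative distance from a receiver to the center of the cluster, and $\mathcal I_0$ is the modified Bessel function of order zero.
   Context: Network model. A reference transmitter $X_0$ is at the origin of the plane, identified with $\mathbb C$; two receivers are at $Y_1=r_0$ and $Y_2=r_0e^{\mathrm{i}\theta}$, both at distance $r_0$ from $X_0$, with $\theta$ the angle between them. There are $M$ interferers at positions $X_1,\dots,X_M$. Put $r_{i,j}=\|X_i-Y_j\|/r_0$ (normalized distance) and $\boldsymbol r=\{r_{i,j}: i\in\{1,\dots,M\},\,j\in\{1,2\}\}$. The path-loss exponent is $\alpha$, the SINR threshold is $\beta$, and $\mathsf{SNR}$ is the signal-to-noise ratio at the receiver. The SINR at $Y_j$ is $$\gamma_j=\frac{g_{0,j}}{\mathsf{SNR}^{-1}+\sum_{i=1}^M I_i\,g_{i,j}\,r_{i,j}^{-\alpha}},$$ where the $g_{i,j}$ are i.i.d. unit-mean exponential random variables (Rayleigh fading) and $I_i$ is a Bernoulli variable with $\mathbb P[I_i=1]=p_i$ (the access probability of interferer $i$). The conditional outage probability is $$\epsilon_j(\boldsymbol r)=\mathbb P[\gamma_j\le\beta\mid\boldsymbol r,M]=1-\exp\left(-\frac{\beta}{\mathsf{SNR}}\right)\prod_{i=1}^M\left(1-p_i+\frac{p_i\,r_{i,j}^\alpha}{\beta+r_{i,j}^\alpha}\right).$$ $\mathbb E_{M,\boldsymbol r}$ denotes expectation over both the number $M$ and the positions of the interferers. The two outage probabilities $\epsilon_1(\boldsymbol r)$ and $\epsilon_2(\boldsymbol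 r)$ are statistically equivalent, so $\mathbb E_{M,\boldsymbol r}[\epsilon_i(\boldsymbol r)]$ is the same for $i=1,2$. Thomas cluster process. Parent points form a homogeneous Poisson point process of intensity $\lambda_{\text{parent}}$; around each parent, offspring points are independently and identically distributed according to a symmetric normal distribution with variance $\sigma^2$, and the number of offspring points per parent is Poisson with intensity (mean) $\lambda'$. Only intra-cluster interference is considered, with the cluster centered at the reference transmitter location, so $M$ is the number of offspring of that cluster. For relative distance $\nu$ from a receiver to the cluster center, $f_r(r\mid\nu)$ is taken as the probability density of the distances in $\boldsymbol r$ conditioned on $\nu$.
   Formalization: In the exponent, 1 + D is replaced by 1 − D (as printed the identity is false, e.g. for p = 0, where D = 1), and in V(σ) the density f_r of the normalized distances uses σ/r_0 in place of σ, which agrees with the printed formula when r_0 = 1. *)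

theory Defs
  imports "HOL-Probability.Probability"
begin

subsection \<open>Interferer positions\<close>

(* A circularly symmetric planar normal law: independent coordinates, each of variance sigma^2. *)
definition offspring_law :: "real \<Rightarrow> complex \<Rightarrow> complex measure" where
  "offspring_law \<sigma> c =
     density lborel
       (\<lambda>z. ennreal (normal_density (Re c) \<sigma> (Re z) * normal_density (Im c) \<sigma> (Im z)))"

(* One cluster of a Thomas process, centred at c.  In a sample (M, X) the offspring points are
   X 1, ..., X M; the remaining entries of the i.i.d. sequence X are unused, which keeps the sample
   space independent of the random number M. *)
definition thomas_cluster :: "real \<Rightarrow> real \<Rightarrow> complex \<Rightarrow> (nat \<times> (nat \<Rightarrow> complex)) measure" where
  "thomas_cluster \<mu> \<sigma> c =
     measure_pmf (poisson_pmf \<mu>) \<Otimes>\<^sub>M (\<Pi>\<^sub>M i\<in>(UNIV :: nat set). offspring_law \<sigma> c)"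

definition receiver :: "real \<Rightarrow> real \<Rightarrow> nat \<Rightarrow> complex" where
  "receiver r0 \<theta> j = (if j = 1 then complex_of_real r0 else complex_of_real r0 * cis \<theta>)"

definition rel_dist :: "real \<Rightarrow> real \<Rightarrow> (nat \<Rightarrow> complex) \<Rightarrow> nat \<Rightarrow> nat \<Rightarrow> real" where
  "rel_dist r0 \<theta> X i j = cmod (X i - receiver r0 \<theta> j) / r0"

subsection \<open>Fading, access and outage\<close>

(* Joint law of the gains g (i, j) (transmitter i, receiver j; i = 0 is the reference transmitter)
   and of the access indicators I i, where a i is the access probability of interferer i. *)
definition fading_access_law ::
    "(nat \<Rightarrow> real) \<Rightarrow> ((nat \<times> nat \<Rightarrow> real) \<times> (nat \<Rightarrow> bool)) measure" where
  "fading_access_law a =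
     (\<Pi>\<^sub>M ij\<in>(UNIV :: (nat \<times> nat) set). density lborel (\<lambda>x. ennreal (exponential_density 1 x)))
     \<Otimes>\<^sub>M (\<Pi>\<^sub>M i\<in>(UNIV :: nat set). measure_pmf (bernoulli_pmf (a i)))"

definition sinr ::
    "real \<Rightarrow> real \<Rightarrow> nat \<Rightarrow> (nat \<Rightarrow> nat \<Rightarrow> real) \<Rightarrow> nat
      \<Rightarrow> (nat \<times> nat \<Rightarrow> real) \<times> (nat \<Rightarrow> bool) \<Rightarrow> real" where
  "sinr \<alpha> SNR m r j = (\<lambda>(g, I).
     g (0, j) / (inverse SNR + (\<Sum>i = 1..m. of_bool (I i) * g (i, j) * r i j powr (- \<alpha>))))"

(* Fading and access are independent of the positions, so conditioning on M = m and on the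
   distances r means holding m and r fixed and averaging over fading and access. *)
definition outage_prob ::
    "real \<Rightarrow> real \<Rightarrow> real \<Rightarrow> (nat \<Rightarrow> real) \<Rightarrow> nat \<Rightarrow> (nat \<Rightarrow> nat \<Rightarrow> real) \<Rightarrow> nat \<Rightarrow> real" where
  "outage_prob \<alpha> \<beta> SNR a m r j =
     measure (fading_access_law a)
       {\<omega> \<in> space (fading_access_law a). sinr \<alpha> SNR m r j \<omega> \<le> \<beta>}"

definition cluster_outage ::
    "real \<Rightarrow> real \<Rightarrow> real \<Rightarrow> (nat \<Rightarrow> real) \<Rightarrow> real \<Rightarrow> real \<Rightarrow> nat
      \<Rightarrow> nat \<times> (nat \<Rightarrow> complex) \<Rightarrow> real" where
  "cluster_outage \<alpha> \<beta> SNR a r0 \<theta> j = (\<lambda>(m, X). outage_prob \<alpha> \<beta> SNR a m (rel_dist r0 \<theta> X) j)"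

subsection \<open>The quantities in the closed form\<close>

(* Modified Bessel function of the first kind of order zero, by its power series. *)
definition bessel_I0 :: "real \<Rightarrow> real" where
  "bessel_I0 x = (\<Sum>k. (x / 2) ^ (2 * k) / (fact k)\<^sup>2)"

(* Rice density: law of the distance from a fixed point to a planar normal point of coordinate
   variance s^2 whose mean is at distance nu from that point. *)
definition dist_density :: "real \<Rightarrow> real \<Rightarrow> real \<Rightarrow> real" where
  "dist_density s \<nu> r =
     r / s\<^sup>2 * exp (- (r\<^sup>2 + \<nu>\<^sup>2) / (2 * s\<^sup>2)) * bessel_I0 (r * \<nu> / s\<^sup>2)"

definition V_term :: "real \<Rightarrow> real \<Rightarrow> real \<Rightarrow> real \<Rightarrow> real" where
  "V_term \<alpha> \<beta> \<nu> s = (LBINT r:{0<..}. r powr \<alpha> / (\<beta> + r powr \<alpha>) * dist_density s \<nu> r)"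

definition polar_dist :: "real \<Rightarrow> real \<Rightarrow> real \<Rightarrow> real \<Rightarrow> real \<Rightarrow> real" where
  "polar_dist r0 \<sigma> \<rho> \<phi> \<theta> =
     cmod (complex_of_real r0 * cis \<theta>
           + complex_of_real (sqrt (- 2 * \<sigma>\<^sup>2 * ln \<rho>)) * cis \<phi>) / r0"

definition X_term :: "real \<Rightarrow> real \<Rightarrow> real \<Rightarrow> real \<Rightarrow> real \<Rightarrow> real" where
  "X_term \<alpha> \<beta> r0 \<sigma> \<theta> =
     1 / (2 * pi) *
     (LBINT \<rho>:{0<..<1}. (LBINT \<phi>:{0<..<2 * pi}.
        polar_dist r0 \<sigma> \<rho> \<phi> 0 powr \<alpha> / (\<beta> + polar_dist r0 \<sigma> \<rho> \<phi> 0 powr \<alpha>) *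
        (polar_dist r0 \<sigma> \<rho> \<phi> \<theta> powr \<alpha> / (\<beta> + polar_dist r0 \<sigma> \<rho> \<phi> \<theta> powr \<alpha>))))"

(* The distances integrated over in V_term are in units of r0, so the deviation of the
   offspring law enters there as sigma / r0; polar_dist does its own division by r0. *)
definition D_term :: "real \<Rightarrow> real \<Rightarrow> real \<Rightarrow> real \<Rightarrow> real \<Rightarrow> real \<Rightarrow> real \<Rightarrow> real" where
  "D_term \<alpha> \<beta> p r0 \<nu> \<sigma> \<theta> =
     (1 - p)\<^sup>2 + 2 * (1 - p) * p * V_term \<alpha> \<beta> \<nu> (\<sigma> / r0) + p\<^sup>2 * X_term \<alpha> \<beta> r0 \<sigma> \<theta>"

end

theory Submission
  imports Defs
begin

text \<open>
  Given the positions, an exponential gain at the reference transmitter turns the success probability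
  into a Laplace transform, which factorizes over the independent interferers; so success has probability
  \<open>e \<cdot> h\<^sub>j(X\<^sub>1) \<cdots> h\<^sub>j(X\<^sub>M)\<close> with \<open>e = exp (- \<beta> / SNR)\<close>.  Expanding \<open>\<epsilon>\<^sub>1\<epsilon>\<^sub>2\<close>, each term is a
  product over the offspring, and the Poisson generating function evaluates its mean as
  \<open>exp (- \<lambda>' (1 - K))\<close>, where \<open>K\<close> is the mean of one factor under the offspring law.  For \<open>h\<^sub>1h\<^sub>2\<close>
  this mean is \<open>D\<close>: its linear terms are integrals against the Rice density, and its quadratic term is
  written in Box--Muller coordinates.
  Polar coordinates are obtained from one-dimensional substitutions only: on the upper half plane put
  \<open>x = y t\<close>, then \<open>t = cot \<phi>\<close> and \<open>y = r sin \<phi>\<close>.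
\<close>

subsection \<open>Polar coordinates\<close>

text \<open>The substitution theorem for absolutely integrable functions is applied to functions
  \<open>indicator A\<close> only. It then says that two measures on the line agree on every Borel
  set, so the integrals of every nonnegative measurable \<open>F\<close> agree, finite or
  not.\<close>

lemma nn_integral_change_of_variables_real:
  fixes F :: "real \<Rightarrow> ennreal" and g g' :: "real \<Rightarrow> real"
  assumes S [measurable]: "S \<in> sets borel" and gS [measurable]: "g ` S \<in> sets borel"
    and der: "\<And>x. x \<in> S \<Longrightarrow> (g has_field_derivative g' x) (at x within S)"
    and inj: "inj_on g S"
    and g [measurable]: "g \<in> borel_measurable borel" and g' [measurable]: "g' \<in> borel_measurable borel"
    and F [measurable]: "F \<in> borel_measurable borel"
  shows "(\<integral>\<^sup>+y. F y * indicator (g ` S) y \<partial>lborel)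
       = (\<integral>\<^sup>+x. ennreal \<bar>g' x\<bar> * F (g x) * indicator S x \<partial>lborel)"
proof -
  have ind: "(\<integral>\<^sup>+y. ennreal (indicator A y) * indicator (g ` S) y \<partial>lborel)
      = (\<integral>\<^sup>+x. ennreal (\<bar>g' x\<bar> * indicator A (g x)) * indicator S x \<partial>lborel)" (is "?L = ?R")
    if A [measurable]: "A \<in> sets borel" for A
  proof -
    let ?f = "indicator A :: real \<Rightarrow> real" and ?h = "\<lambda>x. \<bar>g' x\<bar> * indicator A (g x)"
    \<comment> \<open>\<open>b\<close> is left free: taking it to be the integral of one side gives
      integrability of the other side as well as equality of the values.\<close>
    have cov: "?h absolutely_integrable_on S \<and> integral S ?h = b
        \<longleftrightarrow> ?f absolutely_integrable_on (g ` S) \<and> integral (g ` S) ?f = b" for b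
      by (rule has_absolute_integral_change_of_variables_1'[OF _ der inj]) auto
    \<comment> \<open>Used in contrapositive form: a nonnegative function that is not absolutely
      integrable has infinite integral. Completion bridges \<open>lborel\<close> and the Lebesgue
      measure behind \<open>absolutely_integrable_on\<close>.\<close>
    have fin: "k absolutely_integrable_on T"
      if T [measurable]: "T \<in> sets borel" and k [measurable]: "k \<in> borel_measurable borel"
        and "\<And>x. 0 \<le> k x" and "(\<integral>\<^sup>+x. ennreal (k x) * indicator T x \<partial>lborel) < \<infinity>"
      for k :: "real \<Rightarrow> real" and T
    proof -
      have "(\<lambda>x. indicator T x *\<^sub>R k x) \<in> borel_measurable lborel" by measurable
      moreover have "(\<integral>\<^sup>+x. ennreal (norm (indicator T x *\<^sub>R k x)) \<partial>lborel)
          = (\<integral>\<^sup>+x. ennreal (k x) * indicator T x \<partial>lborel)"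
        using that(3) by (intro nn_integral_cong) (auto simp: indicator_def)
      ultimately have "integrable lborel (\<lambda>x. indicator T x *\<^sub>R k x)"
        using that(4) by (intro integrableI_bounded) auto
      then show ?thesis
        unfolding set_integrable_def by (rule integrable_completion[THEN iffD2, rotated]) measurable
    qed
    show ?thesis
    proof (cases "?f absolutely_integrable_on (g ` S)")
      case True
      define b where "b = integral (g ` S) ?f"
      have h: "?h absolutely_integrable_on S" "integral S ?h = b"
        using cov[of b] True b_def by auto
      have "(?f has_integral b) (g ` S)"
        unfolding b_def using True absolutely_integrable_on_def integrable_integral by blast
      moreover have "(?h has_integral b) S"
        using h absolutely_integrable_on_def integrable_integral by blast
      ultimately show ?thesis
        by (simp add: nn_integral_has_integral_lebesgue'[of _ ?f b] nn_integral_has_integral_lebesgue'[of _ ?h b])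
    next
      \<comment> \<open>Neither side is integrable, so both integrals are infinite and hence
        equal.\<close>
      case False
      then have "\<not> ?h absolutely_integrable_on S" using cov by blast
      then have "\<not> ?R < \<infinity>" using fin[of S ?h] by auto
      moreover have "\<not> ?L < \<infinity>" using fin[of "g ` S" ?f] False by auto
      ultimately show ?thesis by (simp add: not_less top_unique)
    qed
  qed
  \<comment> \<open>Lebesgue measure on the image is the push-forward under \<open>g\<close> of the
    measure on \<open>S\<close> with density \<open>\<bar>g' x\<bar>\<close>.\<close>
  have "density lborel (indicator (g ` S))
      = distr (density lborel (\<lambda>x. ennreal \<bar>g' x\<bar> * indicator S x)) borel g" (is "?M = ?N")
  proof (rule measure_eqI)
    fix A assume "A \<in> sets ?M"
    then have A [measurable]: "A \<in> sets borel" by simp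
    have "emeasure ?N A = (\<integral>\<^sup>+x. ennreal (\<bar>g' x\<bar> * indicator A (g x)) * indicator S x \<partial>lborel)"
      using measurable_sets_borel[OF g A]
      by (subst emeasure_distr, measurable, subst emeasure_density)
        (auto intro!: nn_integral_cong simp: indicator_def)
    moreover have "emeasure ?M A = (\<integral>\<^sup>+y. ennreal (indicator A y) * indicator (g ` S) y \<partial>lborel)"
      by (subst emeasure_density) (auto intro!: nn_integral_cong simp: indicator_def)
    ultimately show "emeasure ?M A = emeasure ?N A" using ind[OF A] by simp
  qed simp
  then have "integral\<^sup>N ?M F = integral\<^sup>N ?N F" by simp
  then show ?thesis
    by (simp add: nn_integral_density nn_integral_distr mult_ac)
qed

section \<open>Planar Lebesgue measure in Cartesian and polar coordinates\<close>

lemma borel_measurable_Complex [measurable]: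
  assumes [measurable]: "f \<in> borel_measurable M" "g \<in> borel_measurable M"
  shows "(\<lambda>x. Complex (f x) (g x)) \<in> borel_measurable M"
  unfolding Complex_eq by measurable

lemma borel_measurable_cis [measurable]: "cis \<in> borel_measurable borel"
  by (intro borel_measurable_continuous_onI continuous_intros)

text \<open>Lebesgue measure is determined by its values on boxes, and \<open>Complex\<close> pulls
  a box back to a product of two intervals.\<close>

lemma lborel_complex: "(lborel :: complex measure) = distr (lborel \<Otimes>\<^sub>M lborel) borel (\<lambda>(x, y). Complex x y)"
proof (rule lborel_eqI)
  fix l u :: complex
  assume le: "\<And>b. b \<in> Basis \<Longrightarrow> l \<bullet> b \<le> u \<bullet> b"
  have "Re l \<le> Re u" "Im l \<le> Im u"
    using le[of 1] le[of \<i>] by (auto simp: Basis_complex_def inner_complex_def)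
  moreover have m [measurable]: "(\<lambda>(x, y). Complex x y) \<in> borel_measurable (lborel \<Otimes>\<^sub>M lborel)"
    by measurable
  moreover have "(\<lambda>(x, y). Complex x y) -` box l u \<inter> space (lborel \<Otimes>\<^sub>M lborel)
      = {Re l<..<Re u} \<times> {Im l<..<Im u}"
    by (auto simp: space_pair_measure box_def Basis_complex_def inner_complex_def)
  ultimately show "emeasure (distr (lborel \<Otimes>\<^sub>M lborel) borel (\<lambda>(x, y). Complex x y)) (box l u)
      = ennreal (\<Prod>b\<in>Basis. (u - l) \<bullet> b)"
    by (subst emeasure_distr)
      (auto simp: lborel.emeasure_pair_measure_Times Basis_complex_def inner_complex_def ennreal_mult)
qed simp

text \<open>The Jacobian factors are \<open>y\<close> from scaling \<open>x\<close>,
  \<open>1 / (sin \<phi>)\<^sup>2\<close> from the cotangent, and \<open>sin \<phi>\<close> twice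
  from \<open>y = r sin \<phi>\<close>: once from the differential and once from the factor
  \<open>y\<close>. Only \<open>r\<close> survives. As \<open>cot\<close> maps
  \<open>{0<..<pi}\<close> bijectively onto the line, the whole half plane is covered once.\<close>

lemma nn_integral_half_plane_polar:
  fixes F :: "complex \<Rightarrow> ennreal"
  assumes F [measurable]: "F \<in> borel_measurable borel"
  shows "(\<integral>\<^sup>+y. (\<integral>\<^sup>+x. F (Complex x y) \<partial>lborel) * indicator {0<..} y \<partial>lborel)
    = (\<integral>\<^sup>+\<phi>. (\<integral>\<^sup>+r. ennreal r * F (r *\<^sub>R cis \<phi>) * indicator {0<..} r \<partial>lborel) * indicator {0<..<pi} \<phi> \<partial>lborel)"
proof -
  have surj: "cot ` {0<..<pi} = (UNIV :: real set)"
  proof -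
    have "t \<in> cot ` {0<..<pi}" for t :: real
    proof -
      have "cot (pi/2 - arctan t) = t"
        by (metis diff_diff_eq2 add_diff_cancel_left' tan_arctan tan_cot')
      moreover have "pi/2 - arctan t \<in> {0<..<pi}"
        using arctan_bounded[of t] by auto
      ultimately show ?thesis by (metis imageI)
    qed
    then show ?thesis by auto
  qed
  have "(\<integral>\<^sup>+y. (\<integral>\<^sup>+x. F (Complex x y) \<partial>lborel) * indicator {0<..} y \<partial>lborel)
      = (\<integral>\<^sup>+y. (\<integral>\<^sup>+t. ennreal y * F (Complex (y * t) y) * indicator {0<..} y \<partial>lborel) \<partial>lborel)"
  proof (rule nn_integral_cong)
    fix y :: real
    show "(\<integral>\<^sup>+x. F (Complex x y) \<partial>lborel) * indicator {0<..} y
      = (\<integral>\<^sup>+t. ennreal y * F (Complex (y * t) y) * indicator {0<..} y \<partial>lborel)"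
      by (cases "y > 0")
        (simp_all add: nn_integral_real_affine[where c=y and t=0 and f="\<lambda>x. F (Complex x y)"] nn_integral_cmult)
  qed
  also have "\<dots> = (\<integral>\<^sup>+t. (\<integral>\<^sup>+y. ennreal y * F (Complex (y * t) y) * indicator {0<..} y \<partial>lborel) \<partial>lborel)"
    by (rule lborel_pair.Fubini') simp
  \<comment> \<open>The image of \<open>cot\<close> is the whole line, so the inserted indicator is
    1; it gives the integral the shape that the substitution expects.\<close>
  also have "\<dots> = (\<integral>\<^sup>+t. (\<integral>\<^sup>+y. ennreal y * F (Complex (y * t) y) * indicator {0<..} y \<partial>lborel)
      * indicator (cot ` {0<..<pi}) t \<partial>lborel)"
    by (simp add: surj)
  also have "\<dots> = (\<integral>\<^sup>+\<phi>. ennreal \<bar>- inverse ((sin \<phi>)\<^sup>2)\<bar>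
      * (\<integral>\<^sup>+y. ennreal y * F (Complex (y * cot \<phi>) y) * indicator {0<..} y \<partial>lborel) * indicator {0<..<pi} \<phi> \<partial>lborel)"
  proof (rule nn_integral_change_of_variables_real)
    show "cot ` {0<..<pi} \<in> sets (borel :: real measure)" by (simp add: surj)
    show "(cot has_real_derivative - inverse ((sin x)\<^sup>2)) (at x within {0<..<pi})"
      if "x \<in> {0<..<pi}" for x
      using that sin_gt_zero[of x] by (auto intro!: DERIV_subset[OF DERIV_cot])
    show "inj_on cot {0<..<pi}"
    proof (rule inj_onI)
      fix x y :: real
      assume xy: "x \<in> {0<..<pi}" "y \<in> {0<..<pi}" and "cot x = cot y"
      then have "tan (pi/2 - x) = tan (pi/2 - y)" by (simp add: tan_cot')
      then have "arctan (tan (pi/2 - x)) = arctan (tan (pi/2 - y))" by simp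
      then show "x = y"
        using xy by (simp add: arctan_tan)
    qed
    show "(cot :: real \<Rightarrow> real) \<in> borel_measurable borel" unfolding cot_def by measurable
  qed measurable
  also have "\<dots> = (\<integral>\<^sup>+\<phi>. (\<integral>\<^sup>+r. ennreal r * F (r *\<^sub>R cis \<phi>) * indicator {0<..} r \<partial>lborel) * indicator {0<..<pi} \<phi> \<partial>lborel)"
  proof (rule nn_integral_cong)
    fix \<phi> :: real
    show "ennreal \<bar>- inverse ((sin \<phi>)\<^sup>2)\<bar>
      * (\<integral>\<^sup>+y. ennreal y * F (Complex (y * cot \<phi>) y) * indicator {0<..} y \<partial>lborel) * indicator {0<..<pi} \<phi>
      = (\<integral>\<^sup>+r. ennreal r * F (r *\<^sub>R cis \<phi>) * indicator {0<..} r \<partial>lborel) * indicator {0<..<pi} \<phi>"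
    proof (cases "\<phi> \<in> {0<..<pi}")
      case True
      then have s: "sin \<phi> > 0" by (auto intro: sin_gt_zero)
      have "(\<integral>\<^sup>+y. ennreal y * F (Complex (y * cot \<phi>) y) * indicator {0<..} y \<partial>lborel)
        = ennreal \<bar>sin \<phi>\<bar> * (\<integral>\<^sup>+r. ennreal (sin \<phi> * r) * F (Complex (sin \<phi> * r * cot \<phi>) (sin \<phi> * r)) * indicator {0<..} (sin \<phi> * r) \<partial>lborel)"
        using s by (subst nn_integral_real_affine[where c="sin \<phi>" and t=0]) auto
      also have "\<dots> = ennreal \<bar>sin \<phi>\<bar> * (\<integral>\<^sup>+r. ennreal (sin \<phi>) * (ennreal r * F (r *\<^sub>R cis \<phi>) * indicator {0<..} r) \<partial>lborel)"
      proof (rule arg_cong[OF nn_integral_cong])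
        fix r
        have "Complex (sin \<phi> * r * cot \<phi>) (sin \<phi> * r) = r *\<^sub>R cis \<phi>"
          using s by (simp add: complex_eq_iff cot_def)
        then show "ennreal (sin \<phi> * r) * F (Complex (sin \<phi> * r * cot \<phi>) (sin \<phi> * r)) * indicator {0<..} (sin \<phi> * r)
          = ennreal (sin \<phi>) * (ennreal r * F (r *\<^sub>R cis \<phi>) * indicator {0<..} r)"
          using s by (auto simp: indicator_def zero_less_mult_iff ennreal_mult mult_ac)
      qed
      also have "\<dots> = ennreal ((sin \<phi>)\<^sup>2) * (\<integral>\<^sup>+r. ennreal r * F (r *\<^sub>R cis \<phi>) * indicator {0<..} r \<partial>lborel)"
        using s by (subst nn_integral_cmult) (simp_all add: power2_eq_square ennreal_mult mult.assoc)
      finally show ?thesis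
        using True s by (simp add: mult.assoc[symmetric] flip: ennreal_mult)
    qed simp
  qed
  finally show ?thesis .
qed

text \<open>The lower half plane is the point reflection of the upper one, so the half-plane formula
  serves twice. The real axis and the single angle \<open>pi\<close> are null sets.\<close>

lemma nn_integral_polar:
  fixes F :: "complex \<Rightarrow> ennreal"
  assumes F [measurable]: "F \<in> borel_measurable borel"
  shows "(\<integral>\<^sup>+z. F z \<partial>lborel)
    = (\<integral>\<^sup>+\<phi>. (\<integral>\<^sup>+r. ennreal r * F (r *\<^sub>R cis \<phi>) * indicator {0<..} r \<partial>lborel) * indicator {0<..<2*pi} \<phi> \<partial>lborel)"
proof -
  define H where "H \<phi> = (\<integral>\<^sup>+r. ennreal r * F (r *\<^sub>R cis \<phi>) * indicator {0<..} r \<partial>lborel)" for \<phi>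
  have H [measurable]: "H \<in> borel_measurable borel"
    unfolding H_def by measurable
  define G where "G y = (\<integral>\<^sup>+x. F (Complex x y) \<partial>lborel)" for y
  have G [measurable]: "G \<in> borel_measurable borel"
    unfolding G_def by measurable
  have "(\<integral>\<^sup>+z. F z \<partial>lborel) = (\<integral>\<^sup>+p. F (Complex (fst p) (snd p)) \<partial>(lborel \<Otimes>\<^sub>M lborel))"
    by (subst lborel_complex, subst nn_integral_distr) (auto simp: case_prod_beta)
  also have "\<dots> = (\<integral>\<^sup>+y. G y \<partial>lborel)"
    unfolding G_def by (subst lborel_pair.nn_integral_snd[symmetric]) auto
  also have "\<dots> = (\<integral>\<^sup>+y. G y * indicator {0<..} y + G y * indicator {..<0} y \<partial>lborel)"
    using AE_lborel_singleton[of "0::real"]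
    by (intro nn_integral_cong_AE) (auto simp: indicator_def elim!: eventually_mono)
  also have "\<dots> = (\<integral>\<^sup>+y. G y * indicator {0<..} y \<partial>lborel) + (\<integral>\<^sup>+y. G y * indicator {..<0} y \<partial>lborel)"
    by (rule nn_integral_add) auto
  also have "(\<integral>\<^sup>+y. G y * indicator {0<..} y \<partial>lborel) = (\<integral>\<^sup>+\<phi>. H \<phi> * indicator {0<..<pi} \<phi> \<partial>lborel)"
    unfolding G_def H_def by (rule nn_integral_half_plane_polar) fact
  also have "(\<integral>\<^sup>+y. G y * indicator {..<0} y \<partial>lborel)
      = (\<integral>\<^sup>+y. (\<integral>\<^sup>+x. F (- Complex x y) \<partial>lborel) * indicator {0<..} y \<partial>lborel)"
  proof -
    have "(\<integral>\<^sup>+y. G y * indicator {..<0} y \<partial>lborel) = (\<integral>\<^sup>+y. G (- y) * indicator {..<0} (- y) \<partial>lborel)"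
      by (subst nn_integral_real_affine[where c="-1" and t=0]) auto
    moreover have "G (- y) = (\<integral>\<^sup>+x. F (- Complex x y) \<partial>lborel)" for y
      unfolding G_def
      by (subst nn_integral_real_affine[where c="-1" and t=0]) (auto simp: complex_eq_iff intro!: nn_integral_cong arg_cong[where f=F])
    ultimately show ?thesis by (simp add: indicator_def)
  qed
  also have "\<dots> = (\<integral>\<^sup>+\<phi>. (\<integral>\<^sup>+r. ennreal r * F (- (r *\<^sub>R cis \<phi>)) * indicator {0<..} r \<partial>lborel) * indicator {0<..<pi} \<phi> \<partial>lborel)"
    by (rule nn_integral_half_plane_polar) simp
  \<comment> \<open>Negation is rotation by \<open>pi\<close>, so the angles of the reflected half
    fill \<open>{pi<..<2*pi}\<close>.\<close>
  also have "\<dots> = (\<integral>\<^sup>+\<phi>. H (pi + \<phi>) * indicator {pi<..<2*pi} (pi + \<phi>) \<partial>lborel)"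
    unfolding H_def by (intro nn_integral_cong) (auto simp: indicator_def cis_mult[symmetric])
  also have "\<dots> = (\<integral>\<^sup>+\<phi>. H \<phi> * indicator {pi<..<2*pi} \<phi> \<partial>lborel)"
    by (subst (2) nn_integral_real_affine[where c="1" and t=pi]) auto
  also have "(\<integral>\<^sup>+\<phi>. H \<phi> * indicator {0<..<pi} \<phi> \<partial>lborel) + (\<integral>\<^sup>+\<phi>. H \<phi> * indicator {pi<..<2*pi} \<phi> \<partial>lborel)
     = (\<integral>\<^sup>+\<phi>. H \<phi> * indicator {0<..<pi} \<phi> + H \<phi> * indicator {pi<..<2*pi} \<phi> \<partial>lborel)"
    by (rule nn_integral_add[symmetric]) auto
  also have "\<dots> = (\<integral>\<^sup>+\<phi>. H \<phi> * indicator {0<..<2*pi} \<phi> \<partial>lborel)"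
    using AE_lborel_singleton[of "pi"] pi_gt_zero
    by (intro nn_integral_cong_AE) (auto simp: indicator_def elim!: eventually_mono)
  finally show ?thesis unfolding H_def .
qed

subsection \<open>The Bessel function as an angular integral\<close>

text \<open>The exponential series is integrated term by term, which leaves the moments
  \<open>J n\<close> of the cosine over a full period. The odd ones vanish and the even ones produce
  the squared factorials. The phase \<theta> disappears because all boundary terms are
  periodic.\<close>

lemma bessel_I0_sums_integral:
  fixes x \<theta> :: real
  shows "(\<lambda>k. 2 * pi * ((x / 2) ^ (2 * k) / (fact k)\<^sup>2)) sums
     (\<integral>\<phi>. indicator {0..2*pi} \<phi> *\<^sub>R exp (x * cos (\<phi> - \<theta>)) \<partial>lborel)"
proof -
  define J where "J n = (\<integral>\<phi>. indicator {0..2*pi} \<phi> *\<^sub>R cos (\<phi> - \<theta>) ^ n \<partial>lborel)" for n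
  have int: "integrable lborel (\<lambda>\<phi>. indicator {0..2*pi} \<phi> *\<^sub>R f \<phi>)"
    if "continuous_on {0..2*pi} f" for f :: "real \<Rightarrow> real"
    using borel_integrable_atLeastAtMost'[OF that] by (simp add: set_integrable_def)
  have J0: "J 0 = 2 * pi" by (simp add: J_def)
  have "((\<lambda>\<phi>. sin (\<phi> - \<theta>)) has_vector_derivative cos (\<phi> - \<theta>)) (at \<phi> within A)" for \<phi> A
    unfolding has_real_derivative_iff_has_vector_derivative[symmetric]
    by (auto intro!: derivative_eq_intros)
  then have "(\<integral>\<phi>. indicator {0..2*pi} \<phi> *\<^sub>R cos (\<phi> - \<theta>) \<partial>lborel) = sin (2*pi - \<theta>) - sin (0 - \<theta>)"
    by (intro integral_FTC_Icc) (auto intro!: continuous_intros)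
  then have J1: "J 1 = 0" by (simp add: J_def sin_diff)
  \<comment> \<open>The recursion integrates the derivative of
    \<open>sin (\<phi> - \<theta>) * cos (\<phi> - \<theta>) ^ (n + 1)\<close> over a period; the
    boundary values cancel.\<close>
  have JSuc: "real (n + 2) * J (n + 2) = real (n + 1) * J n" for n
  proof -
    let ?f = "\<lambda>\<phi>. real (n + 2) * cos (\<phi> - \<theta>) ^ (n + 2) - real (n + 1) * cos (\<phi> - \<theta>) ^ n"
    have "((\<lambda>\<phi>. sin (\<phi> - \<theta>) * cos (\<phi> - \<theta>) ^ (n + 1)) has_vector_derivative ?f \<phi>) (at \<phi> within A)" for \<phi> A
    proof -
      have s: "sin (\<phi> - \<theta>) * sin (\<phi> - \<theta>) = 1 - cos (\<phi> - \<theta>) * cos (\<phi> - \<theta>)"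
        using sin_cos_squared_add[of "\<phi> - \<theta>"] by (simp add: power2_eq_square)
      have "((\<lambda>\<phi>. sin (\<phi> - \<theta>) * cos (\<phi> - \<theta>) ^ (n + 1)) has_real_derivative
          cos (\<phi> - \<theta>) * cos (\<phi> - \<theta>) ^ (n + 1)
          - real (n + 1) * cos (\<phi> - \<theta>) ^ n * (sin (\<phi> - \<theta>) * sin (\<phi> - \<theta>))) (at \<phi> within A)"
      proof -
        have "((\<lambda>\<phi>. sin (\<phi> - \<theta>)) has_real_derivative cos (\<phi> - \<theta>)) (at \<phi> within A)"
          and c: "((\<lambda>\<phi>. cos (\<phi> - \<theta>)) has_real_derivative - sin (\<phi> - \<theta>)) (at \<phi> within A)"
          by (auto intro!: derivative_eq_intros)
        from DERIV_mult'[OF this(1) DERIV_power_Suc[OF c, of n]] show ?thesis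
          unfolding Suc_eq_plus1 by (rule DERIV_cong) (simp add: algebra_simps)
      qed
      also have "cos (\<phi> - \<theta>) * cos (\<phi> - \<theta>) ^ (n + 1)
          - real (n + 1) * cos (\<phi> - \<theta>) ^ n * (sin (\<phi> - \<theta>) * sin (\<phi> - \<theta>)) = ?f \<phi>"
        unfolding s by (simp add: algebra_simps)
      finally show ?thesis by (simp add: has_real_derivative_iff_has_vector_derivative)
    qed
    then have "(\<integral>\<phi>. indicator {0..2*pi} \<phi> *\<^sub>R ?f \<phi> \<partial>lborel)
       = sin (2*pi - \<theta>) * cos (2*pi - \<theta>) ^ (n + 1) - sin (0 - \<theta>) * cos (0 - \<theta>) ^ (n + 1)"
      by (intro integral_FTC_Icc) (auto intro!: continuous_intros)
    then have "(\<integral>\<phi>. indicator {0..2*pi} \<phi> *\<^sub>R ?f \<phi> \<partial>lborel) = 0"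
      by (simp add: sin_diff cos_diff)
    moreover have "(\<integral>\<phi>. indicator {0..2*pi} \<phi> *\<^sub>R ?f \<phi> \<partial>lborel)
      = (\<integral>\<phi>. real (n + 2) * (indicator {0..2*pi} \<phi> *\<^sub>R cos (\<phi> - \<theta>) ^ (n + 2))
           - real (n + 1) * (indicator {0..2*pi} \<phi> *\<^sub>R cos (\<phi> - \<theta>) ^ n) \<partial>lborel)"
      by (intro Bochner_Integration.integral_cong) (auto simp: algebra_simps)
    moreover have "\<dots> = real (n + 2) * J (n + 2) - real (n + 1) * J n"
    proof -
      have "integrable lborel (\<lambda>\<phi>. indicator {0..2*pi} \<phi> *\<^sub>R cos (\<phi> - \<theta>) ^ m)" for m
        by (intro int continuous_intros)
      then show ?thesis
        unfolding J_def
        by (simp only: Bochner_Integration.integral_diff integrable_mult_right integral_mult_right_zero)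
    qed
    ultimately show ?thesis by simp
  qed
  have Jodd: "J (2 * k + 1) = 0" for k
  proof (induction k)
    case (Suc k)
    then show ?case using JSuc[of "2 * k + 1"] by simp
  qed (use J1 in simp)
  have Jeven: "J (2 * k) = 2 * pi * fact (2 * k) / (4 ^ k * (fact k)\<^sup>2)" for k
  proof (induction k)
    case (Suc k)
    have "J (2 * Suc k) = real (2 * k + 1) / real (2 * k + 2) * J (2 * k)"
      using JSuc[of "2 * k"] by (simp add: field_simps)
    also have "\<dots> = 2 * pi * fact (2 * Suc k) / (4 ^ Suc k * (fact (Suc k))\<^sup>2)"
    proof -
      \<comment> \<open>The induction step as an identity in plain variables, so that simplification
        does not unfold factorials and powers.\<close>
      have "y / (2 * u) * (2 * pi * f / (q * g)) = 2 * pi * (2 * u * (y * f)) / ((4 * q) * (u\<^sup>2 * g))"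
        if "u \<noteq> 0" "q \<noteq> 0" "g \<noteq> 0" for y u f q g :: real
        using that by (simp add: field_simps power2_eq_square)
      from this[of "real k + 1" "4 ^ k" "(fact k)\<^sup>2" "real (2 * k + 1)" "fact (2 * k)"]
      have "real (2 * k + 1) / (2 * (real k + 1)) * (2 * pi * fact (2 * k) / (4 ^ k * (fact k)\<^sup>2))
          = 2 * pi * (2 * (real k + 1) * (real (2 * k + 1) * fact (2 * k))) / ((4 * 4 ^ k) * ((real k + 1)\<^sup>2 * (fact k)\<^sup>2))"
        by simp
      moreover have "fact (2 * Suc k) = 2 * (real k + 1) * (real (2 * k + 1) * fact (2 * k))"
        by (simp add: algebra_simps)
      moreover have "(fact (Suc k))\<^sup>2 = (real k + 1)\<^sup>2 * (fact k)\<^sup>2"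
        by (simp add: power_mult_distrib add.commute)
      moreover have "real (2 * k + 2) = 2 * (real k + 1)" by simp
      ultimately show ?thesis
        unfolding Suc.IH by (simp only: power_Suc)
    qed
    finally show ?case .
  qed (simp add: J0)
  let ?F = "\<lambda>n \<phi>. indicator {0..2*pi} \<phi> *\<^sub>R ((x * cos (\<phi> - \<theta>)) ^ n /\<^sub>R fact n)"
  have iF: "integrable lborel (?F n)" for n
    by (intro int continuous_intros)
  have le: "norm (?F n \<phi>) \<le> indicator {0..2*pi} \<phi> *\<^sub>R (\<bar>x\<bar> ^ n /\<^sub>R fact n)" for n \<phi>
  proof -
    have "(\<bar>x\<bar> * \<bar>cos (\<phi> - \<theta>)\<bar>) ^ n \<le> \<bar>x\<bar> ^ n"
      by (intro power_mono) (auto simp: mult_left_le)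
    then show ?thesis
      by (auto simp: indicator_def abs_mult power_abs divide_simps)
  qed
  \<comment> \<open>Both summability conditions for exchanging sum and integral come from the
    majorant \<open>\<bar>x\<bar> ^ n / fact n\<close>, whose sum is the exponential of
    \<open>\<bar>x\<bar>\<close>.\<close>
  have "(\<lambda>n. integral\<^sup>L lborel (?F n)) sums (\<integral>\<phi>. (\<Sum>n. ?F n \<phi>) \<partial>lborel)"
  proof (rule sums_integral[OF iF])
    show "AE \<phi> in lborel. summable (\<lambda>n. norm (?F n \<phi>))"
    proof (intro AE_I2)
      fix \<phi>
      have "summable (\<lambda>n. indicator {0..2*pi} \<phi> *\<^sub>R (\<bar>x\<bar> ^ n /\<^sub>R fact n))"
        by (intro summable_scaleR_right summable_exp_generic)
      then show "summable (\<lambda>n. norm (?F n \<phi>))"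
        by (rule summable_comparison_test'[where N=0]) (use le in simp)
    qed
    have "summable (\<lambda>n. 2 * pi * (\<bar>x\<bar> ^ n /\<^sub>R fact n))"
      by (intro summable_mult summable_exp_generic)
    then show "summable (\<lambda>n. \<integral>\<phi>. norm (?F n \<phi>) \<partial>lborel)"
    proof (rule summable_comparison_test'[where N=0])
      fix n
      have "(\<integral>\<phi>. norm (?F n \<phi>) \<partial>lborel) \<le> (\<integral>\<phi>. indicator {0..2*pi} \<phi> *\<^sub>R (\<bar>x\<bar> ^ n /\<^sub>R fact n) \<partial>lborel)"
        by (intro integral_mono integrable_norm iF le int continuous_intros)
      also have "\<dots> = 2 * pi * (\<bar>x\<bar> ^ n /\<^sub>R fact n)" by simp
      finally show "norm (\<integral>\<phi>. norm (?F n \<phi>) \<partial>lborel) \<le> 2 * pi * (\<bar>x\<bar> ^ n /\<^sub>R fact n)"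
        by simp
    qed
  qed
  moreover have "(\<Sum>n. ?F n \<phi>) = indicator {0..2*pi} \<phi> *\<^sub>R exp (x * cos (\<phi> - \<theta>))" for \<phi>
    by (simp add: indicator_def exp_def)
  moreover have "integral\<^sup>L lborel (?F n) = x ^ n / fact n * J n" for n
  proof -
    have "?F n = (\<lambda>\<phi>. x ^ n / fact n * (indicator {0..2*pi} \<phi> *\<^sub>R cos (\<phi> - \<theta>) ^ n))"
      by (auto simp: power_mult_distrib divide_simps)
    then show ?thesis unfolding J_def by simp
  qed
  ultimately have "(\<lambda>n. x ^ n / fact n * J n) sums
     (\<integral>\<phi>. indicator {0..2*pi} \<phi> *\<^sub>R exp (x * cos (\<phi> - \<theta>)) \<partial>lborel)" by simp
  \<comment> \<open>The terms off the even indices are zero, so the series may be reindexed along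
    \<open>n = 2 * k\<close>.\<close>
  moreover have "J n = 0" if "n \<notin> range ((*) 2)" for n
  proof -
    from that have "odd n" by auto
    then show ?thesis using Jodd by (auto elim!: oddE)
  qed
  ultimately have "(\<lambda>k. x ^ (2 * k) / fact (2 * k) * J (2 * k)) sums
     (\<integral>\<phi>. indicator {0..2*pi} \<phi> *\<^sub>R exp (x * cos (\<phi> - \<theta>)) \<partial>lborel)"
    by (subst sums_mono_reindex[where g="(*) 2" and f="\<lambda>n. x ^ n / fact n * J n"]) (auto simp: strict_mono_def)
  moreover have "x ^ (2 * k) / fact (2 * k) * J (2 * k) = 2 * pi * ((x / 2) ^ (2 * k) / (fact k)\<^sup>2)" for k
    unfolding Jeven by (simp add: power_divide power_mult)
  ultimately show ?thesis by simp
qed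

lemma bessel_I0_summable: "summable (\<lambda>k. (x / 2) ^ (2 * k) / (fact k)\<^sup>2 :: real)"
proof -
  have "summable (\<lambda>k. 2 * pi * ((x / 2) ^ (2 * k) / (fact k)\<^sup>2))"
    using bessel_I0_sums_integral sums_summable by blast
  from summable_divide[OF this, of "2 * pi"] show ?thesis by simp
qed

lemma bessel_I0_nonneg: "0 \<le> bessel_I0 x"
  unfolding bessel_I0_def by (intro suminf_nonneg bessel_I0_summable) (simp add: power_mult)

lemma bessel_I0_minus: "bessel_I0 (- x) = bessel_I0 x"
  by (simp add: bessel_I0_def)

lemma borel_measurable_bessel_I0 [measurable]: "bessel_I0 \<in> borel_measurable borel"
  unfolding bessel_I0_def[abs_def] by measurable

text \<open>This evaluates the angular integral in the distance law below; independence of \<theta>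
  means that the direction of the receiver does not matter.\<close>

lemma nn_integral_exp_cos:
  "(\<integral>\<^sup>+\<phi>. ennreal (exp (x * cos (\<phi> - \<theta>))) * indicator {0<..<2*pi} \<phi> \<partial>lborel) = ennreal (2 * pi * bessel_I0 x)"
proof -
  have "(\<integral>\<phi>. indicator {0..2*pi} \<phi> *\<^sub>R exp (x * cos (\<phi> - \<theta>)) \<partial>lborel) = 2 * pi * bessel_I0 x"
    using sums_unique[OF bessel_I0_sums_integral[of x \<theta>]] suminf_mult[OF bessel_I0_summable, of "2*pi" x]
    unfolding bessel_I0_def by argo
  moreover have "integrable lborel (\<lambda>\<phi>. indicator {0..2*pi} \<phi> *\<^sub>R exp (x * cos (\<phi> - \<theta>)))"
    by (intro borel_integrable_atLeastAtMost'[unfolded set_integrable_def] continuous_intros)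
  ultimately have "(\<integral>\<^sup>+\<phi>. ennreal (indicator {0..2*pi} \<phi> *\<^sub>R exp (x * cos (\<phi> - \<theta>))) \<partial>lborel)
      = ennreal (2 * pi * bessel_I0 x)"
    by (subst nn_integral_eq_integral) auto
  moreover have "(\<integral>\<^sup>+\<phi>. ennreal (exp (x * cos (\<phi> - \<theta>))) * indicator {0<..<2*pi} \<phi> \<partial>lborel)
     = (\<integral>\<^sup>+\<phi>. ennreal (indicator {0..2*pi} \<phi> *\<^sub>R exp (x * cos (\<phi> - \<theta>))) \<partial>lborel)"
    using AE_lborel_singleton[of "0::real"] AE_lborel_singleton[of "2*pi"]
    by (intro nn_integral_cong_AE) (auto simp: indicator_def elim!: eventually_elim2)
  ultimately show ?thesis by simp
qed

subsection \<open>The offspring law\<close>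

text \<open>With equal variances the joint density depends on the distance to the centre only, which
  is what makes polar coordinates effective.\<close>

lemma normal_density_complex:
  assumes "\<sigma> > 0"
  shows "normal_density (Re c) \<sigma> (Re z) * normal_density (Im c) \<sigma> (Im z)
    = exp (- (cmod (z - c))\<^sup>2 / (2 * \<sigma>\<^sup>2)) / (2 * pi * \<sigma>\<^sup>2)"
proof -
  have "sqrt (2 * pi * \<sigma>\<^sup>2) * sqrt (2 * pi * \<sigma>\<^sup>2) = 2 * pi * \<sigma>\<^sup>2"
    by simp
  then show ?thesis
    by (simp add: normal_density_def cmod_power2 add_divide_distrib exp_add[symmetric] diff_divide_distrib)
qed

lemma sets_offspring_law [simp, measurable_cong]: "sets (offspring_law \<sigma> c) = sets borel"
  by (simp add: offspring_law_def)

lemma space_offspring_law [simp]: "space (offspring_law \<sigma> c) = UNIV"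
  by (simp add: offspring_law_def)

lemma nn_integral_offspring_law:
  assumes "\<sigma> > 0" and [measurable]: "F \<in> borel_measurable borel"
  shows "(\<integral>\<^sup>+z. F z \<partial>offspring_law \<sigma> c)
    = (\<integral>\<^sup>+z. ennreal (exp (- (cmod (z - c))\<^sup>2 / (2 * \<sigma>\<^sup>2)) / (2 * pi * \<sigma>\<^sup>2)) * F z \<partial>lborel)"
  unfolding offspring_law_def normal_density_complex[OF assms(1)]
  by (rule nn_integral_density) auto

text \<open>Under \<open>r = sqrt (- 2 * \<sigma>\<^sup>2 * ln \<rho>)\<close> the Gaussian factor
  becomes \<rho> and the radial measure becomes uniform on \<open>{0<..<1}\<close>. The minus sign
  in the argument of \<open>F\<close> anticipates \<open>polar_dist\<close>, which adds the
  displacement to the receiver instead of subtracting the receiver from the offspring point.\<close>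

lemma nn_integral_offspring_law_box_muller:
  assumes \<sigma>: "\<sigma> > 0" and F [measurable]: "F \<in> borel_measurable borel"
  shows "(\<integral>\<^sup>+z. F z \<partial>offspring_law \<sigma> 0)
    = ennreal (1 / (2 * pi)) * (\<integral>\<^sup>+\<rho>. (\<integral>\<^sup>+\<phi>. F (- (sqrt (- 2 * \<sigma>\<^sup>2 * ln \<rho>) *\<^sub>R cis \<phi>)) * indicator {0<..<2*pi} \<phi> \<partial>lborel)
        * indicator {0<..<1} \<rho> \<partial>lborel)"
proof -
  define d where "d r = exp (- r\<^sup>2 / (2 * \<sigma>\<^sup>2)) / (2 * pi * \<sigma>\<^sup>2)" for r
  have [measurable]: "d \<in> borel_measurable borel" unfolding d_def by measurable
  define g where "g \<rho> = sqrt (- 2 * \<sigma>\<^sup>2 * ln \<rho>)" for \<rho>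
  define g' where "g' \<rho> = - \<sigma>\<^sup>2 / (\<rho> * g \<rho>)" for \<rho>
  have [measurable]: "g \<in> borel_measurable borel" "g' \<in> borel_measurable borel"
    unfolding g_def g'_def by measurable
  have g_pos: "g \<rho> > 0" if "\<rho> \<in> {0<..<1}" for \<rho>
    using that \<sigma> by (simp add: g_def mult_pos_neg)
  have g_exp: "exp (- (g \<rho>)\<^sup>2 / (2 * \<sigma>\<^sup>2)) = \<rho>" if "\<rho> \<in> {0<..<1}" for \<rho>
    using that g_pos[OF that] \<sigma> by (simp add: g_def)
  have img: "g ` {0<..<1} = {0<..}"
  proof (intro equalityI subsetI)
    fix r :: real assume "r \<in> {0<..}"
    then have "r = g (exp (- r\<^sup>2 / (2 * \<sigma>\<^sup>2)))" "exp (- r\<^sup>2 / (2 * \<sigma>\<^sup>2)) \<in> {0<..<1}"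
      using \<sigma> by (auto simp: g_def)
    then show "r \<in> g ` {0<..<1}" by blast
  qed (use g_pos in auto)
  have "(\<integral>\<^sup>+z. F z \<partial>offspring_law \<sigma> 0) = (\<integral>\<^sup>+z. ennreal (d (cmod z)) * F z \<partial>lborel)"
    by (simp add: nn_integral_offspring_law[OF \<sigma>] d_def)
  \<comment> \<open>The law is centred at 0, hence invariant under negation; this introduces the
    sign.\<close>
  also have "\<dots> = (\<integral>\<^sup>+z. ennreal (d (cmod z)) * F (- z) \<partial>lborel)"
    by (subst lborel_affine[of "-1" "0::complex"]) (simp_all add: nn_integral_density nn_integral_distr)
  also have "\<dots> = (\<integral>\<^sup>+\<phi>. (\<integral>\<^sup>+r. ennreal r * (ennreal (d (cmod (r *\<^sub>R cis \<phi>))) * F (- (r *\<^sub>R cis \<phi>))) * indicator {0<..} r \<partial>lborel)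
       * indicator {0<..<2*pi} \<phi> \<partial>lborel)"
    by (rule nn_integral_polar) simp
  also have "\<dots> = (\<integral>\<^sup>+\<phi>. (\<integral>\<^sup>+\<rho>. ennreal (1 / (2 * pi)) * (F (- (g \<rho> *\<^sub>R cis \<phi>)) * indicator {0<..<2*pi} \<phi> * indicator {0<..<1} \<rho>) \<partial>lborel) \<partial>lborel)"
  proof (rule nn_integral_cong)
    fix \<phi>
    have "(\<integral>\<^sup>+r. ennreal r * (ennreal (d (cmod (r *\<^sub>R cis \<phi>))) * F (- (r *\<^sub>R cis \<phi>))) * indicator {0<..} r \<partial>lborel)
       = (\<integral>\<^sup>+\<rho>. ennreal \<bar>g' \<rho>\<bar> * (ennreal (g \<rho>) * (ennreal (d (cmod (g \<rho> *\<^sub>R cis \<phi>))) * F (- (g \<rho> *\<^sub>R cis \<phi>)))) * indicator {0<..<1} \<rho> \<partial>lborel)"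
      unfolding img[symmetric]
    proof (rule nn_integral_change_of_variables_real)
      fix \<rho> :: real assume \<rho>: "\<rho> \<in> {0<..<1}"
      then have "0 < - 2 * \<sigma>\<^sup>2 * ln \<rho>" using \<sigma> by (simp add: mult_pos_neg)
      then show "(g has_real_derivative g' \<rho>) (at \<rho> within {0<..<1})"
        unfolding g_def[abs_def] g'_def
        using \<rho> \<sigma> by (auto intro!: derivative_eq_intros simp: field_simps)
    next
      show "inj_on g {0<..<1}"
        by (rule inj_on_inverseI[of _ "\<lambda>r. exp (- r\<^sup>2 / (2 * \<sigma>\<^sup>2))"]) (rule g_exp)
    qed (auto simp: img)
    also have "\<dots> = (\<integral>\<^sup>+\<rho>. ennreal (1 / (2 * pi)) * (F (- (g \<rho> *\<^sub>R cis \<phi>)) * indicator {0<..<1} \<rho>) \<partial>lborel)"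
    proof (rule nn_integral_cong)
      fix \<rho> :: real
      \<comment> \<open>The product is \<open>\<sigma>\<^sup>2 / (\<rho> * g \<rho>)\<close> times
        \<open>g \<rho>\<close> times \<open>\<rho> / (2 * pi * \<sigma>\<^sup>2)\<close>:
        everything but the angular constant cancels.\<close>
      have "\<bar>g' \<rho>\<bar> * (g \<rho> * d (cmod (g \<rho> *\<^sub>R cis \<phi>))) = 1 / (2 * pi)" if "\<rho> \<in> {0<..<1}"
        using that g_pos[OF that] g_exp[OF that] \<sigma> by (simp add: d_def g'_def abs_mult)
      then have "ennreal \<bar>g' \<rho>\<bar> * (ennreal (g \<rho>) * ennreal (d (cmod (g \<rho> *\<^sub>R cis \<phi>)))) = ennreal (1 / (2 * pi))"
        if "\<rho> \<in> {0<..<1}"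
        using that g_pos[OF that] by (metis abs_ge_zero ennreal_mult'' ennreal_mult' less_imp_le)
      then show "ennreal \<bar>g' \<rho>\<bar> * (ennreal (g \<rho>) * (ennreal (d (cmod (g \<rho> *\<^sub>R cis \<phi>))) * F (- (g \<rho> *\<^sub>R cis \<phi>)))) * indicator {0<..<1} \<rho>
        = ennreal (1 / (2 * pi)) * (F (- (g \<rho> *\<^sub>R cis \<phi>)) * indicator {0<..<1} \<rho>)"
        by (cases "\<rho> \<in> {0<..<1}") (simp_all add: mult.assoc[symmetric])
    qed
    finally show "(\<integral>\<^sup>+r. ennreal r * (ennreal (d (cmod (r *\<^sub>R cis \<phi>))) * F (- (r *\<^sub>R cis \<phi>))) * indicator {0<..} r \<partial>lborel)
       * indicator {0<..<2*pi} \<phi> = (\<integral>\<^sup>+\<rho>. ennreal (1 / (2 * pi)) * (F (- (g \<rho> *\<^sub>R cis \<phi>)) * indicator {0<..<2*pi} \<phi> * indicator {0<..<1} \<rho>) \<partial>lborel)"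
      by (cases "\<phi> \<in> {0<..<2*pi}") simp_all
  qed
  also have "\<dots> = (\<integral>\<^sup>+\<rho>. (\<integral>\<^sup>+\<phi>. ennreal (1 / (2 * pi)) * (F (- (g \<rho> *\<^sub>R cis \<phi>)) * indicator {0<..<2*pi} \<phi> * indicator {0<..<1} \<rho>) \<partial>lborel) \<partial>lborel)"
    by (rule lborel_pair.Fubini') simp
  also have "\<dots> = ennreal (1 / (2 * pi)) * (\<integral>\<^sup>+\<rho>. (\<integral>\<^sup>+\<phi>. F (- (g \<rho> *\<^sub>R cis \<phi>)) * indicator {0<..<2*pi} \<phi> \<partial>lborel)
        * indicator {0<..<1} \<rho> \<partial>lborel)"
    by (simp add: nn_integral_cmult nn_integral_multc)
  finally show ?thesis unfolding g_def .
qed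

text \<open>Polar coordinates are centred at the receiver \<open>c\<close>. By the law of cosines
  the angle enters through \<open>exp (x * cos (\<phi> - t))\<close> only, and integrating it out
  gives the Bessel factor of the Rice density.\<close>

lemma nn_integral_offspring_law_dist:
  assumes \<sigma>: "\<sigma> > 0" and r0: "r0 > 0" and c: "cmod c = r0"
    and h [measurable]: "h \<in> borel_measurable borel"
  shows "(\<integral>\<^sup>+z. h (cmod (z - c) / r0) \<partial>offspring_law \<sigma> 0)
    = (\<integral>\<^sup>+s. ennreal (dist_density (\<sigma> / r0) 1 s) * h s * indicator {0<..} s \<partial>lborel)"
proof -
  obtain t where t: "c = r0 *\<^sub>R cis t"
    using c by (metis rcis_cmod_Arg rcis_def scaleR_conv_of_real)
  \<comment> \<open>\<open>d r \<phi>\<close> is the offspring density at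
    \<open>c + r *\<^sub>R cis \<phi>\<close>, already split into a radial factor and the factor
    that carries the angle.\<close>
  define d where "d r \<phi> = exp (- (r0\<^sup>2 + r\<^sup>2) / (2 * \<sigma>\<^sup>2)) / (2 * pi * \<sigma>\<^sup>2) * exp (- (r * r0 / \<sigma>\<^sup>2) * cos (\<phi> - t))" for r \<phi>
  have [measurable]: "(\<lambda>(r, \<phi>). d r \<phi>) \<in> borel_measurable (borel \<Otimes>\<^sub>M borel)"
    unfolding d_def by measurable
  have d: "exp (- (cmod (c + r *\<^sub>R cis \<phi>))\<^sup>2 / (2 * \<sigma>\<^sup>2)) / (2 * pi * \<sigma>\<^sup>2) = d r \<phi>" for r \<phi>
  proof -
    have "(cmod (c + r *\<^sub>R cis \<phi>))\<^sup>2
        = (r0 * cos t + r * cos \<phi>)\<^sup>2 + (r0 * sin t + r * sin \<phi>)\<^sup>2"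
      by (simp add: t cmod_power2)
    also have "\<dots> = r0\<^sup>2 + r\<^sup>2 + 2 * r * r0 * cos (\<phi> - t)"
      unfolding cos_diff using sin_cos_squared_add[of t] sin_cos_squared_add[of \<phi>] by algebra
    finally have "(cmod (c + r *\<^sub>R cis \<phi>))\<^sup>2 = r0\<^sup>2 + r\<^sup>2 + 2 * r * r0 * cos (\<phi> - t)" .
    then show ?thesis
      using \<sigma> unfolding d_def
      by (simp add: exp_add[symmetric] add_divide_distrib diff_divide_distrib)
  qed
  have "(\<integral>\<^sup>+z. h (cmod (z - c) / r0) \<partial>offspring_law \<sigma> 0)
     = (\<integral>\<^sup>+z. ennreal (exp (- (cmod z)\<^sup>2 / (2 * \<sigma>\<^sup>2)) / (2 * pi * \<sigma>\<^sup>2)) * h (cmod (z - c) / r0) \<partial>lborel)"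
    by (simp add: nn_integral_offspring_law[OF \<sigma>])
  also have "\<dots> = (\<integral>\<^sup>+z. ennreal (exp (- (cmod (c + z))\<^sup>2 / (2 * \<sigma>\<^sup>2)) / (2 * pi * \<sigma>\<^sup>2)) * h (cmod z / r0) \<partial>lborel)"
    by (subst lborel_distr_plus[of c, symmetric], subst nn_integral_distr) auto
  also have "\<dots> = (\<integral>\<^sup>+\<phi>. (\<integral>\<^sup>+r. ennreal r * (ennreal (d r \<phi>) * h (cmod (r *\<^sub>R cis \<phi>) / r0)) * indicator {0<..} r \<partial>lborel)
       * indicator {0<..<2*pi} \<phi> \<partial>lborel)"
    unfolding d[symmetric] by (rule nn_integral_polar) simp
  also have "\<dots> = (\<integral>\<^sup>+\<phi>. (\<integral>\<^sup>+r. ennreal r * h (r / r0) * indicator {0<..} r * (ennreal (d r \<phi>) * indicator {0<..<2*pi} \<phi>) \<partial>lborel) \<partial>lborel)"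
  proof (rule nn_integral_cong)
    fix \<phi>
    show "(\<integral>\<^sup>+r. ennreal r * (ennreal (d r \<phi>) * h (cmod (r *\<^sub>R cis \<phi>) / r0)) * indicator {0<..} r \<partial>lborel)
       * indicator {0<..<2*pi} \<phi> = (\<integral>\<^sup>+r. ennreal r * h (r / r0) * indicator {0<..} r * (ennreal (d r \<phi>) * indicator {0<..<2*pi} \<phi>) \<partial>lborel)"
      by (subst nn_integral_multc[symmetric]) (auto intro!: nn_integral_cong simp: indicator_def mult_ac)
  qed
  also have "\<dots> = (\<integral>\<^sup>+r. (\<integral>\<^sup>+\<phi>. ennreal r * h (r / r0) * indicator {0<..} r * (ennreal (d r \<phi>) * indicator {0<..<2*pi} \<phi>) \<partial>lborel) \<partial>lborel)"
    by (rule lborel_pair.Fubini') simp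
  also have "\<dots> = (\<integral>\<^sup>+r. ennreal r * h (r / r0) * indicator {0<..} r * (\<integral>\<^sup>+\<phi>. ennreal (d r \<phi>) * indicator {0<..<2*pi} \<phi> \<partial>lborel) \<partial>lborel)"
    by (simp add: nn_integral_cmult)
  also have "\<dots> = (\<integral>\<^sup>+r. ennreal r * h (r / r0) * indicator {0<..} r
      * ennreal (exp (- (r0\<^sup>2 + r\<^sup>2) / (2 * \<sigma>\<^sup>2)) / \<sigma>\<^sup>2 * bessel_I0 (r * r0 / \<sigma>\<^sup>2)) \<partial>lborel)"
  proof -
    have "(\<integral>\<^sup>+\<phi>. ennreal (d r \<phi>) * indicator {0<..<2*pi} \<phi> \<partial>lborel)
       = ennreal (exp (- (r0\<^sup>2 + r\<^sup>2) / (2 * \<sigma>\<^sup>2)) / (2 * pi * \<sigma>\<^sup>2)) * (\<integral>\<^sup>+\<phi>. ennreal (exp (- (r * r0 / \<sigma>\<^sup>2) * cos (\<phi> - t))) * indicator {0<..<2*pi} \<phi> \<partial>lborel)" for r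
      unfolding d_def by (subst nn_integral_cmult[symmetric], measurable) (simp only: ennreal_mult'' exp_ge_zero mult.assoc)
    \<comment> \<open>The cosine comes with a negative coefficient; the sign is absorbed because the
      Bessel function is even.\<close>
    then show ?thesis
      by (simp add: nn_integral_exp_cos[of "- (r * r0 / \<sigma>\<^sup>2)" for r, simplified] bessel_I0_minus ennreal_mult[symmetric] bessel_I0_nonneg)
  qed
  \<comment> \<open>Passing to units of \<open>r0\<close> gives one factor \<open>r0\<close> from
    the differential and one from \<open>r\<close>; together with
    \<open>1 / \<sigma>\<^sup>2\<close> they form \<open>1 / (\<sigma> / r0)\<^sup>2\<close>, and
    the centre moves to relative distance 1.\<close>
  also have "\<dots> = (\<integral>\<^sup>+s. ennreal (dist_density (\<sigma> / r0) 1 s) * h s * indicator {0<..} s \<partial>lborel)"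
  proof (subst nn_integral_real_affine[where c=r0 and t=0])
    show "ennreal \<bar>r0\<bar> * (\<integral>\<^sup>+s. ennreal (0 + r0 * s) * h ((0 + r0 * s) / r0) * indicator {0<..} (0 + r0 * s)
        * ennreal (exp (- (r0\<^sup>2 + (0 + r0 * s)\<^sup>2) / (2 * \<sigma>\<^sup>2)) / \<sigma>\<^sup>2 * bessel_I0 ((0 + r0 * s) * r0 / \<sigma>\<^sup>2)) \<partial>lborel)
       = (\<integral>\<^sup>+s. ennreal (dist_density (\<sigma> / r0) 1 s) * h s * indicator {0<..} s \<partial>lborel)"
    proof (subst nn_integral_cmult[symmetric], simp, rule nn_integral_cong)
      fix s :: real
      have "r0 * (r0 * s) * (exp (- (r0\<^sup>2 + (r0 * s)\<^sup>2) / (2 * \<sigma>\<^sup>2)) / \<sigma>\<^sup>2 * bessel_I0 (r0 * s * r0 / \<sigma>\<^sup>2))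
         = dist_density (\<sigma> / r0) 1 s"
        using r0 \<sigma> by (simp add: dist_density_def power_divide field_simps power2_eq_square)
      then have *: "ennreal r0 * (ennreal (r0 * s) * ennreal (exp (- (r0\<^sup>2 + (r0 * s)\<^sup>2) / (2 * \<sigma>\<^sup>2)) / \<sigma>\<^sup>2 * bessel_I0 (r0 * s * r0 / \<sigma>\<^sup>2)))
         = ennreal (dist_density (\<sigma> / r0) 1 s)" if "s > 0"
        using that r0 bessel_I0_nonneg by (metis ennreal_mult' less_imp_le mult.assoc mult_nonneg_nonneg)
      show "ennreal \<bar>r0\<bar> * (ennreal (0 + r0 * s) * h ((0 + r0 * s) / r0) * indicator {0<..} (0 + r0 * s)
        * ennreal (exp (- (r0\<^sup>2 + (0 + r0 * s)\<^sup>2) / (2 * \<sigma>\<^sup>2)) / \<sigma>\<^sup>2 * bessel_I0 ((0 + r0 * s) * r0 / \<sigma>\<^sup>2)))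
         = ennreal (dist_density (\<sigma> / r0) 1 s) * h s * indicator {0<..} s"
      proof (cases "s > 0")
        case True
        have "ennreal r0 * (ennreal (r0 * s) * h s * ennreal E) = ennreal r0 * (ennreal (r0 * s) * ennreal E) * h s" for E
          by (simp only: mult_ac)
        with *[OF True] True r0 show ?thesis by simp
      qed (use r0 in \<open>simp add: zero_less_mult_iff\<close>)
    qed
  qed (use r0 in auto)
  finally show ?thesis .
qed

text \<open>For nonnegative measurable functions the Bochner integral is \<open>enn2real\<close> of
  the nonnegative integral, so the previous identity transfers directly.\<close>

lemma integral_offspring_law_dist:
  fixes h :: "real \<Rightarrow> real"
  assumes \<sigma>: "\<sigma> > 0" and r0: "r0 > 0" and c: "cmod c = r0"
    and h [measurable]: "h \<in> borel_measurable borel" and h0: "\<And>s. 0 \<le> h s"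
  shows "(\<integral>z. h (cmod (z - c) / r0) \<partial>offspring_law \<sigma> 0)
    = (LBINT s:{0<..}. h s * dist_density (\<sigma> / r0) 1 s)"
proof -
  have [measurable]: "dist_density (\<sigma> / r0) 1 \<in> borel_measurable borel"
    unfolding dist_density_def by measurable
  have d0: "0 \<le> dist_density (\<sigma> / r0) 1 s" if "0 \<le> s" for s
    using that by (simp add: dist_density_def bessel_I0_nonneg)
  have "(\<integral>z. h (cmod (z - c) / r0) \<partial>offspring_law \<sigma> 0)
     = enn2real (\<integral>\<^sup>+z. ennreal (h (cmod (z - c) / r0)) \<partial>offspring_law \<sigma> 0)"
    by (rule integral_eq_nn_integral) (auto simp: h0)
  also have "(\<integral>\<^sup>+z. ennreal (h (cmod (z - c) / r0)) \<partial>offspring_law \<sigma> 0)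
     = (\<integral>\<^sup>+s. ennreal (dist_density (\<sigma> / r0) 1 s) * ennreal (h s) * indicator {0<..} s \<partial>lborel)"
    by (rule nn_integral_offspring_law_dist[OF \<sigma> r0 c]) measurable
  also have "\<dots> = (\<integral>\<^sup>+s. ennreal (indicator {0<..} s *\<^sub>R (h s * dist_density (\<sigma> / r0) 1 s)) \<partial>lborel)"
    by (intro nn_integral_cong) (auto simp: indicator_def h0 d0 ennreal_mult mult.commute)
  also have "enn2real \<dots> = (LBINT s:{0<..}. h s * dist_density (\<sigma> / r0) 1 s)"
    unfolding set_lebesgue_integral_def
    by (rule integral_eq_nn_integral[symmetric]) (auto simp: indicator_def h0 d0)
  finally show ?thesis .
qed

text \<open>The bound \<open>F z \<le> 1\<close> makes every angular integral finite, so the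
  iterated nonnegative integral turns into an iterated real one.\<close>

lemma integral_offspring_law_box_muller:
  fixes F :: "complex \<Rightarrow> real"
  assumes \<sigma>: "\<sigma> > 0" and F [measurable]: "F \<in> borel_measurable borel"
    and F0: "\<And>z. 0 \<le> F z" and F1: "\<And>z. F z \<le> 1"
  shows "(\<integral>z. F z \<partial>offspring_law \<sigma> 0)
    = 1 / (2 * pi) * (LBINT \<rho>:{0<..<1}. (LBINT \<phi>:{0<..<2*pi}. F (- (sqrt (- 2 * \<sigma>\<^sup>2 * ln \<rho>) *\<^sub>R cis \<phi>))))"
proof -
  let ?f = "\<lambda>\<rho> \<phi>. F (- (sqrt (- 2 * \<sigma>\<^sup>2 * ln \<rho>) *\<^sub>R cis \<phi>))"
  define I where "I \<rho> = (LBINT \<phi>:{0<..<2*pi}. ?f \<rho> \<phi>)" for \<rho>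
  have [measurable]: "I \<in> borel_measurable borel"
    unfolding I_def set_lebesgue_integral_def by measurable
  have I0: "0 \<le> I \<rho>" for \<rho>
    unfolding I_def set_lebesgue_integral_def by (rule Bochner_Integration.integral_nonneg) (simp add: F0)
  have I: "(\<integral>\<^sup>+\<phi>. ennreal (?f \<rho> \<phi>) * indicator {0<..<2*pi} \<phi> \<partial>lborel) = ennreal (I \<rho>)" for \<rho>
  proof -
    have "integrable lborel (\<lambda>\<phi>. indicator {0<..<2*pi} \<phi> *\<^sub>R ?f \<rho> \<phi>)"
      by (rule Bochner_Integration.integrable_bound[of _ "indicator {0<..<2*pi} :: real \<Rightarrow> real"])
        (auto simp: indicator_def F0 F1)
    then have "(\<integral>\<^sup>+\<phi>. ennreal (indicator {0<..<2*pi} \<phi> *\<^sub>R ?f \<rho> \<phi>) \<partial>lborel) = ennreal (I \<rho>)"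
      unfolding I_def set_lebesgue_integral_def by (rule nn_integral_eq_integral) (simp add: F0)
    moreover have "(\<integral>\<^sup>+\<phi>. ennreal (?f \<rho> \<phi>) * indicator {0<..<2*pi} \<phi> \<partial>lborel)
        = (\<integral>\<^sup>+\<phi>. ennreal (indicator {0<..<2*pi} \<phi> *\<^sub>R ?f \<rho> \<phi>) \<partial>lborel)"
      by (intro nn_integral_cong) (auto simp: indicator_def)
    ultimately show ?thesis by simp
  qed
  have "(\<integral>z. F z \<partial>offspring_law \<sigma> 0) = enn2real (\<integral>\<^sup>+z. ennreal (F z) \<partial>offspring_law \<sigma> 0)"
    by (rule integral_eq_nn_integral) (auto simp: F0)
  also have "(\<integral>\<^sup>+z. ennreal (F z) \<partial>offspring_law \<sigma> 0)
     = ennreal (1 / (2 * pi)) * (\<integral>\<^sup>+\<rho>. ennreal (I \<rho>) * indicator {0<..<1} \<rho> \<partial>lborel)"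
    unfolding I[symmetric] by (rule nn_integral_offspring_law_box_muller[OF \<sigma>]) measurable
  also have "\<dots> = ennreal (1 / (2 * pi)) * (\<integral>\<^sup>+\<rho>. ennreal (indicator {0<..<1} \<rho> *\<^sub>R I \<rho>) \<partial>lborel)"
    by (intro arg_cong2[where f="(*)"] refl nn_integral_cong) (auto simp: indicator_def)
  also have "enn2real \<dots> = 1 / (2 * pi) * (LBINT \<rho>:{0<..<1}. I \<rho>)"
    unfolding set_lebesgue_integral_def
    by (subst integral_eq_nn_integral) (auto simp: enn2real_mult I0)
  finally show ?thesis unfolding I_def .
qed

subsection \<open>Outage under Rayleigh fading\<close>

lemma (in product_prob_space) integral_PiM_restrict:
  fixes f :: "('i \<Rightarrow> 'a) \<Rightarrow> real"
  assumes "finite J" "J \<subseteq> I" and [measurable]: "f \<in> borel_measurable (PiM J M)"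
  shows "(\<integral>x. f (restrict x J) \<partial>PiM I M) = integral\<^sup>L (PiM J M) f"
  using assms
  by (subst distr_PiM_restrict_finite[symmetric, of J], simp, simp)
    (subst integral_distr, auto intro!: measurable_restrict_subset)

text \<open>Independence: the integrand sees only the coordinates in \<open>J\<close>, whose joint
  law is the finite product measure.\<close>

lemma (in product_prob_space) integral_PiM_prod:
  fixes f :: "'i \<Rightarrow> 'a \<Rightarrow> real"
  assumes "finite J" "J \<subseteq> I" and int: "\<And>i. i \<in> J \<Longrightarrow> integrable (M i) (f i)"
  shows "(\<integral>x. (\<Prod>i\<in>J. f i (x i)) \<partial>PiM I M) = (\<Prod>i\<in>J. integral\<^sup>L (M i) (f i))"
proof -
  have [measurable]: "f i \<in> borel_measurable (M i)" if "i \<in> J" for i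
    using int[OF that] by simp
  have "(\<integral>x. (\<Prod>i\<in>J. f i (x i)) \<partial>PiM I M) = (\<integral>x. (\<Prod>i\<in>J. f i (restrict x J i)) \<partial>PiM I M)"
    by (intro Bochner_Integration.integral_cong prod.cong) auto
  also have "\<dots> = (\<integral>x. (\<Prod>i\<in>J. f i (x i)) \<partial>PiM J M)"
    by (rule integral_PiM_restrict[OF assms(1,2)]) measurable
  also have "\<dots> = (\<Prod>i\<in>J. integral\<^sup>L (M i) (f i))"
    by (rule product_integral_prod[OF assms(1) int])
  finally show ?thesis .
qed

section \<open>Exponential gains and the success probability at fixed positions\<close>

abbreviation exponential_law :: "real measure" where
  "exponential_law \<equiv> density lborel (\<lambda>x. ennreal (exponential_density 1 x))"

lemma prob_space_exponential_law: "prob_space exponential_law"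
  by (rule prob_space_exponential_density) simp

lemma exponential_law_tail:
  assumes "0 \<le> t"
  shows "(\<integral>y. of_bool (t < y) \<partial>exponential_law) = exp (- t)"
proof -
  interpret prob_space exponential_law by (rule prob_space_exponential_law)
  have "distr exponential_law lborel (\<lambda>x. x) = exponential_law"
    by (rule distr_id2) simp
  then have "distributed exponential_law lborel (\<lambda>x. x) (exponential_density 1)"
    unfolding distributed_def by simp
  from exponential_distributedD_gt[OF this assms] have "prob {y. t < y} = exp (- t)"
    by simp
  moreover have "(\<integral>y. of_bool (t < y) \<partial>exponential_law) = prob {y. t < y}"
  proof -
    have "(\<lambda>y. of_bool (t < y) :: real) = indicator {y. t < y}" by (auto simp: indicator_def)
    then show ?thesis by simp
  qed
  ultimately show ?thesis by simp
qed

text \<open>Exponential tilting: \<open>exp (- b * y)\<close> times the unit-rate density is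
  \<open>1 / (1 + b)\<close> times the density of rate \<open>1 + b\<close>, which has total mass
  1.\<close>

lemma exponential_law_laplace:
  assumes "0 \<le> b"
  shows "(\<integral>y. exp (- b * y) \<partial>exponential_law) = 1 / (1 + b)"
proof -
  interpret prob_space "density lborel (exponential_density (1 + b))"
    by (rule prob_space_exponential_density) (use assms in simp)
  have "(\<integral>y. exp (- b * y) \<partial>exponential_law) = (\<integral>y. exponential_density 1 y * exp (- b * y) \<partial>lborel)"
    by (subst integral_density) (auto simp: exponential_density_nonneg)
  also have "\<dots> = (\<integral>y. 1 / (1 + b) * exponential_density (1 + b) y \<partial>lborel)"
    using assms by (intro Bochner_Integration.integral_cong)
      (auto simp: exponential_density_def exp_add[symmetric] field_simps)
  also have "\<dots> = 1 / (1 + b) * (\<integral>y. exponential_density (1 + b) y * 1 \<partial>lborel)"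
    by simp
  also have "(\<integral>y. exponential_density (1 + b) y * 1 \<partial>lborel) = (\<integral>y. 1 \<partial>density lborel (exponential_density (1 + b)))"
    using assms by (subst integral_density) (auto intro!: exponential_density_nonneg)
  finally show ?thesis using prob_space by simp
qed

text \<open>Integrating out the reference gain first gives the exponential tail at \<beta> times
  noise plus interference. That exponential is a product over the independent interfering gains,
  each contributing a Laplace transform.\<close>

lemma rayleigh_success:
  fixes c :: "nat \<Rightarrow> real"
  assumes \<beta>: "\<beta> > 0" and N: "N > 0" and c: "\<And>i. 0 \<le> c i"
  shows "(\<integral>g. of_bool (\<beta> < g (0, j) / (N + (\<Sum>i = 1..m. c i * g (i, j)))) \<partial>PiM (UNIV :: (nat \<times> nat) set) (\<lambda>_. exponential_law))
    = exp (- \<beta> * N) * (\<Prod>i = 1..m. 1 / (1 + \<beta> * c i))"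
proof -
  interpret E: prob_space exponential_law by (rule prob_space_exponential_law)
  \<comment> \<open>\<open>K\<close> indexes the interfering gains. Interferers are numbered from 1,
    so the reference gain \<open>(0, j)\<close> lies outside it.\<close>
  define K where "K = (\<lambda>i. (i, j)) ` {1..m}"
  interpret U: product_prob_space "\<lambda>_. exponential_law" "UNIV :: (nat \<times> nat) set" by unfold_locales
  interpret K: product_prob_space "\<lambda>_. exponential_law" K by unfold_locales
  interpret J: product_prob_space "\<lambda>_. exponential_law" "insert (0, j) K" by unfold_locales
  have finK: "finite K" and notin: "(0, j) \<notin> K" by (auto simp: K_def)
  define S where "S g = (\<Sum>k\<in>K. c (fst k) * g k)" for g :: "nat \<times> nat \<Rightarrow> real"
  have S: "(\<Sum>i = 1..m. c i * g (i, j)) = S g" for g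
    by (simp add: S_def K_def sum.reindex inj_on_def)
  have [measurable]: "S \<in> borel_measurable (PiM K (\<lambda>_. exponential_law))"
    unfolding S_def by measurable
  have [measurable]: "S \<in> borel_measurable (PiM (insert (0, j) K) (\<lambda>_. exponential_law))"
    unfolding S_def by measurable
  let ?\<Phi> = "\<lambda>g. of_bool (\<beta> < g (0, j) / (N + S g)) :: real"
  have \<Phi> [measurable]: "?\<Phi> \<in> borel_measurable (PiM (insert (0, j) K) (\<lambda>_. exponential_law))"
    by measurable
  have "integral\<^sup>L (PiM UNIV (\<lambda>_. exponential_law)) ?\<Phi>
     = (\<integral>g. ?\<Phi> (restrict g (insert (0, j) K)) \<partial>PiM UNIV (\<lambda>_. exponential_law))"
    by (simp add: S_def)
  also have "\<dots> = integral\<^sup>L (PiM (insert (0, j) K) (\<lambda>_. exponential_law)) ?\<Phi>"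
    using finK by (intro U.integral_PiM_restrict) auto
  also have "\<dots> = (\<integral>x. (\<integral>y. ?\<Phi> (x((0, j) := y)) \<partial>exponential_law) \<partial>PiM K (\<lambda>_. exponential_law))"
    by (rule U.product_integral_insert[OF finK notin], rule J.P.integrable_const_bound[of _ 1]) auto
  also have "\<dots> = (\<integral>x. (\<integral>y. of_bool (\<beta> < y / (N + S x)) \<partial>exponential_law) \<partial>PiM K (\<lambda>_. exponential_law))"
  proof -
    have "S (x((0, j) := y)) = S x" for x y
      unfolding S_def using notin by (intro sum.cong) auto
    then show ?thesis by simp
  qed
  also have "\<dots> = (\<integral>x. exp (- \<beta> * N) * (\<Prod>k\<in>K. exp (- (\<beta> * c (fst k)) * x k)) \<partial>PiM K (\<lambda>_. exponential_law))"
  proof (rule integral_cong_AE)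
    \<comment> \<open>Gains are nonnegative almost surely; only then is the denominator known to be
      positive and may be cleared from the inequality.\<close>
    have "AE y in exponential_law. 0 \<le> y"
      by (subst AE_density) (auto simp: exponential_density_def)
    then have "AE x in PiM K (\<lambda>_. exponential_law). \<forall>k\<in>K. 0 \<le> x k"
      using finK by (auto intro!: AE_finite_allI K.AE_component)
    then show "AE x in PiM K (\<lambda>_. exponential_law). (\<integral>y. of_bool (\<beta> < y / (N + S x)) \<partial>exponential_law)
        = exp (- \<beta> * N) * (\<Prod>k\<in>K. exp (- (\<beta> * c (fst k)) * x k))"
    proof (eventually_elim)
      case (elim x)
      then have "0 \<le> S x" unfolding S_def using c by (intro sum_nonneg mult_nonneg_nonneg) auto
      then have "(\<beta> < y / (N + S x)) \<longleftrightarrow> \<beta> * (N + S x) < y" for y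
        using N by (simp add: less_divide_eq)
      then have "(\<integral>y. of_bool (\<beta> < y / (N + S x)) \<partial>exponential_law) = exp (- (\<beta> * (N + S x)))"
        using exponential_law_tail[of "\<beta> * (N + S x)"] \<beta> N \<open>0 \<le> S x\<close> by simp
      also have "\<dots> = exp (- \<beta> * N) * exp (\<Sum>k\<in>K. - (\<beta> * c (fst k)) * x k)"
        unfolding S_def by (simp add: exp_add[symmetric] sum_negf sum_distrib_left algebra_simps)
      finally show ?case by (simp add: exp_sum finK)
    qed
  qed measurable
  also have "\<dots> = exp (- \<beta> * N) * (\<Prod>k\<in>K. \<integral>y. exp (- (\<beta> * c (fst k)) * y) \<partial>exponential_law)"
  proof -
    have "integrable exponential_law (\<lambda>y. exp (- b * y))" if "0 \<le> b" for b
    proof (rule E.integrable_const_bound[of _ 1])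
      have "AE y in exponential_law. 0 \<le> y"
        by (subst AE_density) (auto simp: exponential_density_def)
      then show "AE y in exponential_law. norm (exp (- b * y)) \<le> 1"
        by eventually_elim (use that in auto)
    qed measurable
    then have "(\<integral>x. (\<Prod>k\<in>K. exp (- (\<beta> * c (fst k)) * x k)) \<partial>PiM K (\<lambda>_. exponential_law))
       = (\<Prod>k\<in>K. \<integral>y. exp (- (\<beta> * c (fst k)) * y) \<partial>exponential_law)"
      using \<beta> c by (intro U.product_integral_prod finK) (auto simp del: mult_minus_left)
    then show ?thesis by simp
  qed
  also have "\<dots> = exp (- \<beta> * N) * (\<Prod>k\<in>K. 1 / (1 + \<beta> * c (fst k)))"
    using \<beta> c by (simp only: exponential_law_laplace mult_nonneg_nonneg less_imp_le)
  also have "\<dots> = exp (- \<beta> * N) * (\<Prod>i = 1..m. 1 / (1 + \<beta> * c i))"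
    by (simp add: K_def prod.reindex inj_on_def)
  finally show ?thesis unfolding S .
qed

text \<open>This holds also at distance \<open>0\<close>, where \<open>powr\<close> gives \<open>0\<close> on both sides; the form
  \<open>r\<^sup>\<alpha> / (\<beta> + r\<^sup>\<alpha>)\<close> of the factor is valid only for positive distances, hence almost surely.\<close>

lemma outage_prob_eq:
  assumes \<beta>: "\<beta> > 0" and SNR: "SNR > 0" and a: "\<And>i. 0 \<le> a i" "\<And>i. a i \<le> 1"
  shows "outage_prob \<alpha> \<beta> SNR a m r j
    = 1 - exp (- \<beta> / SNR) * (\<Prod>i = 1..m. 1 - a i + a i / (1 + \<beta> * r i j powr (- \<alpha>)))"
proof -
  define G where "G = PiM (UNIV :: (nat \<times> nat) set) (\<lambda>_. exponential_law)"
  define B where "B = PiM (UNIV :: nat set) (\<lambda>i. measure_pmf (bernoulli_pmf (a i)))"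
  interpret E: prob_space exponential_law by (rule prob_space_exponential_law)
  interpret U: product_prob_space "\<lambda>_. exponential_law" "UNIV :: (nat \<times> nat) set" by unfold_locales
  interpret P: product_prob_space "\<lambda>i. measure_pmf (bernoulli_pmf (a i))" "UNIV :: nat set" by unfold_locales
  interpret G: prob_space G unfolding G_def by (rule U.P.prob_space_axioms)
  interpret B: prob_space B unfolding B_def by (rule P.P.prob_space_axioms)
  interpret GB: pair_prob_space G B ..
  have law: "fading_access_law a = G \<Otimes>\<^sub>M B"
    by (simp add: fading_access_law_def G_def B_def)
  let ?w = "\<lambda>i. r i j powr (- \<alpha>)"
  have [measurable]: "(\<lambda>\<omega>. fst \<omega> ij) \<in> borel_measurable (G \<Otimes>\<^sub>M B)" for ij
    unfolding G_def by measurable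
  have [measurable]: "(\<lambda>\<omega>. snd \<omega> i) \<in> measurable (G \<Otimes>\<^sub>M B) (count_space UNIV)" for i
    unfolding B_def by measurable
  have [measurable]: "sinr \<alpha> SNR m r j \<in> borel_measurable (G \<Otimes>\<^sub>M B)"
    unfolding sinr_def case_prod_beta by measurable
  have "outage_prob \<alpha> \<beta> SNR a m r j = 1 - measure (G \<Otimes>\<^sub>M B) {\<omega> \<in> space (G \<Otimes>\<^sub>M B). \<beta> < sinr \<alpha> SNR m r j \<omega>}"
    unfolding outage_prob_def law
    by (subst GB.prob_neg[symmetric]) (auto simp: not_less)
  also have "measure (G \<Otimes>\<^sub>M B) {\<omega> \<in> space (G \<Otimes>\<^sub>M B). \<beta> < sinr \<alpha> SNR m r j \<omega>}
     = (\<integral>\<omega>. indicator {\<omega> \<in> space (G \<Otimes>\<^sub>M B). \<beta> < sinr \<alpha> SNR m r j \<omega>} \<omega> \<partial>(G \<Otimes>\<^sub>M B))"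
    by simp
  also have "\<dots> = (\<integral>(g, I). of_bool (\<beta> < sinr \<alpha> SNR m r j (g, I)) \<partial>(G \<Otimes>\<^sub>M B))"
    by (intro Bochner_Integration.integral_cong) (auto simp: indicator_def)
  \<comment> \<open>Fading is averaged first with the access indicators fixed, so that they act as
    weights 0 or 1 on the path losses.\<close>
  also have "\<dots> = (\<integral>I. (\<integral>g. of_bool (\<beta> < sinr \<alpha> SNR m r j (g, I)) \<partial>G) \<partial>B)"
  proof (rule GB.integral_snd[symmetric])
    show "integrable (G \<Otimes>\<^sub>M B) (\<lambda>(g, I). of_bool (\<beta> < sinr \<alpha> SNR m r j (g, I)) :: real)"
      by (rule GB.integrable_const_bound[of _ 1]) auto
  qed
  also have "\<dots> = (\<integral>I. exp (- \<beta> / SNR) * (\<Prod>i = 1..m. 1 / (1 + \<beta> * (of_bool (I i) * ?w i))) \<partial>B)"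
  proof (intro Bochner_Integration.integral_cong refl)
    fix I :: "nat \<Rightarrow> bool"
    have "sinr \<alpha> SNR m r j (g, I) = g (0, j) / (inverse SNR + (\<Sum>i = 1..m. of_bool (I i) * ?w i * g (i, j)))" for g
      by (simp add: sinr_def mult_ac)
    then show "(\<integral>g. of_bool (\<beta> < sinr \<alpha> SNR m r j (g, I)) \<partial>G)
        = exp (- \<beta> / SNR) * (\<Prod>i = 1..m. 1 / (1 + \<beta> * (of_bool (I i) * ?w i)))"
      unfolding G_def using rayleigh_success[OF \<beta>, of "inverse SNR" "\<lambda>i. of_bool (I i) * ?w i" j m] SNR
      by (simp add: divide_inverse)
  qed
  also have "\<dots> = exp (- \<beta> / SNR) * (\<Prod>i = 1..m. \<integral>b. 1 / (1 + \<beta> * (of_bool b * ?w i)) \<partial>measure_pmf (bernoulli_pmf (a i)))"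
    unfolding B_def
    by (subst P.integral_PiM_prod[symmetric]) (auto intro!: integrable_measure_pmf_finite)
  \<comment> \<open>A silent interferer contributes 1 with probability \<open>1 - a i\<close>, an
    active one \<open>1 / (1 + \<beta> * ?w i)\<close> with probability \<open>a i\<close>.\<close>
  also have "\<dots> = exp (- \<beta> / SNR) * (\<Prod>i = 1..m. 1 - a i + a i / (1 + \<beta> * ?w i))"
    using a by (simp add: algebra_simps)
  finally show ?thesis .
qed

subsection \<open>Averaging over the cluster\<close>

text \<open>The total mass is the Box--Muller formula for the constant function 1.\<close>

lemma prob_space_offspring_law:
  assumes \<sigma>: "\<sigma> > 0"
  shows "prob_space (offspring_law \<sigma> 0)"
proof
  have "emeasure (offspring_law \<sigma> 0) (space (offspring_law \<sigma> 0)) = (\<integral>\<^sup>+z. 1 \<partial>offspring_law \<sigma> 0)"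
    by simp
  also have "\<dots> = ennreal (1 / (2 * pi)) * ennreal (2 * pi)"
    by (subst nn_integral_offspring_law_box_muller[OF \<sigma>]) (simp_all add: nn_integral_cmult_indicator)
  also have "\<dots> = 1" by (simp flip: ennreal_mult)
  finally show "emeasure (offspring_law \<sigma> 0) (space (offspring_law \<sigma> 0)) = 1" .
qed

lemma poisson_generating_function:
  assumes "\<mu> > 0"
  shows "(\<integral>m. k ^ m \<partial>measure_pmf (poisson_pmf \<mu>)) = exp (- \<mu> * (1 - k :: real))"
proof -
  have s: "(\<lambda>m. exp (- \<mu>) * ((c * \<mu>) ^ m /\<^sub>R fact m)) sums (exp (- \<mu>) * exp (c * \<mu>))" for c :: real
    by (intro sums_mult exp_converges)
  have eq: "pmf (poisson_pmf \<mu>) m *\<^sub>R c ^ m = exp (- \<mu>) * ((c * \<mu>) ^ m /\<^sub>R fact m)" for c :: real and m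
    using assms by (simp add: power_mult_distrib divide_inverse)
  have "integrable (count_space UNIV) (\<lambda>m. pmf (poisson_pmf \<mu>) m *\<^sub>R k ^ m)"
    using s[of "\<bar>k\<bar>"] assms unfolding integrable_count_space_nat_iff eq
    by (auto simp: abs_mult power_abs dest: sums_summable)
  then have "(\<integral>m. k ^ m \<partial>measure_pmf (poisson_pmf \<mu>)) = (\<Sum>m. pmf (poisson_pmf \<mu>) m *\<^sub>R k ^ m)"
    unfolding measure_pmf_eq_density
    by (subst integral_density) (auto simp: integral_count_space_nat)
  also have "\<dots> = exp (- \<mu>) * exp (k * \<mu>)"
    unfolding eq using s by (rule sums_unique[symmetric])
  finally show ?thesis by (simp add: exp_add[symmetric] algebra_simps)
qed

section \<open>Expectations of products over the random cluster\<close>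

lemma prob_space_thomas_cluster:
  assumes "\<sigma> > 0"
  shows "prob_space (thomas_cluster \<mu> \<sigma> 0)"
proof -
  interpret O: prob_space "offspring_law \<sigma> 0" by (rule prob_space_offspring_law[OF assms])
  interpret U: product_prob_space "\<lambda>_. offspring_law \<sigma> 0" "UNIV :: nat set" by unfold_locales
  interpret pair_prob_space "measure_pmf (poisson_pmf \<mu>)" "PiM (UNIV :: nat set) (\<lambda>_. offspring_law \<sigma> 0)" ..
  show ?thesis unfolding thomas_cluster_def by (rule prob_space_axioms)
qed

text \<open>The number of factors is random but takes countably many values, and for each fixed
  value the product is measurable.\<close>

lemma thomas_cluster_prod_measurable:
  assumes [measurable]: "h \<in> borel_measurable borel"
  shows "(\<lambda>(m, X). \<Prod>i = 1..m. h (X i) :: real) \<in> borel_measurable (thomas_cluster \<mu> \<sigma> 0)"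
  unfolding thomas_cluster_def case_prod_beta
  by (rule measurable_compose_countable'[where g=fst and I=UNIV]) measurable

lemma thomas_cluster_prod_integrable:
  assumes \<sigma>: "\<sigma> > 0" and h [measurable]: "h \<in> borel_measurable borel"
    and h0: "\<And>z. 0 \<le> h z" and h1: "\<And>z. h z \<le> 1"
  shows "integrable (thomas_cluster \<mu> \<sigma> 0) (\<lambda>(m, X). \<Prod>i = 1..m. h (X i) :: real)"
proof -
  interpret prob_space "thomas_cluster \<mu> \<sigma> 0" by (rule prob_space_thomas_cluster[OF \<sigma>])
  show ?thesis
  proof (rule integrable_const_bound[of _ 1])
    have "\<bar>\<Prod>i = 1..m. h (X i)\<bar> \<le> 1" for m :: nat and X :: "nat \<Rightarrow> complex"
      by (simp add: abs_of_nonneg prod_nonneg h0 prod_le_1 h1)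
    then show "AE \<omega> in thomas_cluster \<mu> \<sigma> 0. norm ((\<lambda>(m, X). \<Prod>i = 1..m. h (X i)) \<omega>) \<le> 1"
      by (intro AE_I2) (auto simp: case_prod_beta)
  qed (rule thomas_cluster_prod_measurable[OF h])
qed

text \<open>Given \<open>m\<close> offspring, independence gives the \<open>m\<close>-th power of
  the one-point mean; the Poisson generating function then averages over \<open>m\<close>.\<close>

lemma thomas_cluster_prod_integral:
  assumes \<mu>: "\<mu> > 0" and \<sigma>: "\<sigma> > 0" and h [measurable]: "h \<in> borel_measurable borel"
    and h0: "\<And>z. 0 \<le> h z" and h1: "\<And>z. h z \<le> 1"
  shows "(\<integral>(m, X). (\<Prod>i = 1..m. h (X i)) \<partial>thomas_cluster \<mu> \<sigma> 0)
    = exp (- \<mu> * (1 - (\<integral>z. h z \<partial>offspring_law \<sigma> 0)))"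
proof -
  interpret O: prob_space "offspring_law \<sigma> 0" by (rule prob_space_offspring_law[OF \<sigma>])
  interpret U: product_prob_space "\<lambda>_. offspring_law \<sigma> 0" "UNIV :: nat set" by unfold_locales
  interpret pair_prob_space "measure_pmf (poisson_pmf \<mu>)" "PiM (UNIV :: nat set) (\<lambda>_. offspring_law \<sigma> 0)" ..
  have "integrable (offspring_law \<sigma> 0) h"
    by (rule O.integrable_const_bound[of _ 1]) (auto simp: h0 h1)
  then have "(\<integral>X. (\<Prod>i = 1..m. h (X i)) \<partial>PiM (UNIV :: nat set) (\<lambda>_. offspring_law \<sigma> 0))
      = (\<integral>z. h z \<partial>offspring_law \<sigma> 0) ^ m" for m
    by (subst U.integral_PiM_prod) auto
  moreover have "(\<integral>(m, X). (\<Prod>i = 1..m. h (X i)) \<partial>thomas_cluster \<mu> \<sigma> 0)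
     = (\<integral>m. (\<integral>X. (\<Prod>i = 1..m. h (X i)) \<partial>PiM (UNIV :: nat set) (\<lambda>_. offspring_law \<sigma> 0)) \<partial>measure_pmf (poisson_pmf \<mu>))"
    unfolding thomas_cluster_def
    by (rule integral_fst[symmetric]) (use thomas_cluster_prod_integrable[OF \<sigma> h h0 h1] in \<open>simp add: thomas_cluster_def\<close>)
  ultimately show ?thesis by (simp add: poisson_generating_function[OF \<mu>])
qed

section \<open>Assembly of the joint outage moment\<close>

theorem theorem6:
  fixes \<alpha> \<beta> SNR p r0 \<nu> \<sigma> \<theta> lambda' :: real
    and a :: "nat \<Rightarrow> real"
    and j :: nat
  assumes "\<alpha> > 0" and "\<beta> > 0" and "SNR > 0" and "r0 > 0" and "\<sigma> > 0" and "lambda' > 0"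
    and "0 \<le> p" and "p \<le> 1"
    and "\<And>i. a i = p"
    and "j \<in> {1, 2}"
    and "\<nu> = cmod (receiver r0 \<theta> j - 0) / r0"
  shows "(\<integral>\<omega>. cluster_outage \<alpha> \<beta> SNR a r0 \<theta> 1 \<omega> * cluster_outage \<alpha> \<beta> SNR a r0 \<theta> 2 \<omega>
            \<partial>thomas_cluster lambda' \<sigma> 0)
         = 2 * (\<integral>\<omega>. cluster_outage \<alpha> \<beta> SNR a r0 \<theta> j \<omega> \<partial>thomas_cluster lambda' \<sigma> 0) - 1
           + exp (- 2 * \<beta> / SNR - lambda' * (1 - D_term \<alpha> \<beta> p r0 \<nu> \<sigma> \<theta>))"
proof -
  note \<alpha> = assms(1) and \<beta> = assms(2) and SNR = assms(3) and r0 = assms(4) and \<sigma> = assms(5)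
    and \<mu> = assms(6) and p0 = assms(7) and p1 = assms(8) and a = assms(9)
  let ?T = "thomas_cluster lambda' \<sigma> 0" and ?O = "offspring_law \<sigma> 0"
  interpret T: prob_space ?T by (rule prob_space_thomas_cluster[OF \<sigma>])
  interpret O: prob_space ?O by (rule prob_space_offspring_law[OF \<sigma>])
  have rec: "cmod (receiver r0 \<theta> k) = r0" for k
    using r0 by (simp add: receiver_def norm_mult)
  \<comment> \<open>The cluster centre is the reference transmitter, at distance \<open>r0\<close>
    from either receiver, and \<open>r0\<close> is the unit of relative distance.\<close>
  have \<nu>: "\<nu> = 1" using assms(11) r0 by (simp add: rec)
  \<comment> \<open>This form of the factor is the one delivered by the fading average. At
    \<open>s = 0\<close> it equals 1 while
    \<open>s powr \<alpha> / (\<beta> + s powr \<alpha>)\<close> equals 0; the two agree for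
    \<open>s > 0\<close>.\<close>
  define q where "q s = 1 / (1 + \<beta> * s powr (- \<alpha>))" for s
  have q [measurable]: "q \<in> borel_measurable borel" unfolding q_def by measurable
  have q0: "0 \<le> q s" and q1: "q s \<le> 1" for s
    using \<beta> by (auto simp: q_def divide_simps add_pos_nonneg)
  have q_eq: "q s = s powr \<alpha> / (\<beta> + s powr \<alpha>)" if "s > 0" for s
    using that \<beta> by (simp add: q_def powr_minus divide_simps add_pos_pos add.commute)
  define u where "u k z = q (cmod (z - receiver r0 \<theta> k) / r0)" for k z
  have u [measurable]: "u k \<in> borel_measurable borel" for k unfolding u_def by measurable
  have u0: "0 \<le> u k z" and u1: "u k z \<le> 1" for k z by (simp_all add: u_def q0 q1)
  have int_u: "integrable ?O (u k)" for k
    by (rule O.integrable_const_bound[of _ 1]) (auto simp: u0 u1)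
  have int_uu: "integrable ?O (\<lambda>z. u 1 z * u 2 z)"
    by (rule O.integrable_const_bound[of _ 1]) (auto simp: u0 u1 abs_mult mult_le_one)
  have V: "(\<integral>z. u k z \<partial>?O) = V_term \<alpha> \<beta> \<nu> (\<sigma> / r0)" for k
    unfolding u_def V_term_def \<nu>
    by (subst integral_offspring_law_dist[OF \<sigma> r0 rec q q0])
      (auto intro!: set_lebesgue_integral_cong simp: q_eq)
  have X: "(\<integral>z. u 1 z * u 2 z \<partial>?O) = X_term \<alpha> \<beta> r0 \<sigma> \<theta>"
  proof -
    define v where "v k z = (cmod (z - receiver r0 \<theta> k) / r0) powr \<alpha>
      / (\<beta> + (cmod (z - receiver r0 \<theta> k) / r0) powr \<alpha>)" for k z
    have [measurable]: "v k \<in> borel_measurable borel" for k unfolding v_def by measurable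
    have v0: "0 \<le> v k z" and v1: "v k z \<le> 1" for k z
      using \<beta> by (auto simp: v_def divide_simps add_pos_nonneg)
    have v_polar: "v k (- (sqrt (- 2 * \<sigma>\<^sup>2 * ln \<rho>) *\<^sub>R cis \<phi>))
        = polar_dist r0 \<sigma> \<rho> \<phi> t powr \<alpha> / (\<beta> + polar_dist r0 \<sigma> \<rho> \<phi> t powr \<alpha>)"
      if "receiver r0 \<theta> k = r0 * cis t" for k \<rho> \<phi> t
    proof -
      have "cmod (- (sqrt (- 2 * \<sigma>\<^sup>2 * ln \<rho>) *\<^sub>R cis \<phi>) - receiver r0 \<theta> k) / r0 = polar_dist r0 \<sigma> \<rho> \<phi> t"
        unfolding polar_dist_def that scaleR_conv_of_real
        by (subst norm_minus_cancel[symmetric]) (simp add: add.commute)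
      then show ?thesis unfolding v_def by simp
    qed
    \<comment> \<open>The two forms of the factor can differ only if an offspring point hits a
      receiver, which is a null event.\<close>
    have "AE z in ?O. z \<noteq> receiver r0 \<theta> k" for k
      unfolding offspring_law_def using AE_lborel_singleton[of "receiver r0 \<theta> k"]
      by (subst AE_density) (auto elim: eventually_mono)
    from this[of 1] this[of 2] have "AE z in ?O. u 1 z * u 2 z = v 1 z * v 2 z"
      by eventually_elim (use r0 in \<open>simp add: u_def v_def q_eq\<close>)
    then have "(\<integral>z. u 1 z * u 2 z \<partial>?O) = (\<integral>z. v 1 z * v 2 z \<partial>?O)"
      by (intro integral_cong_AE) auto
    also have "\<dots> = 1 / (2 * pi) * (LBINT \<rho>:{0<..<1}. (LBINT \<phi>:{0<..<2*pi}.
        v 1 (- (sqrt (- 2 * \<sigma>\<^sup>2 * ln \<rho>) *\<^sub>R cis \<phi>)) * v 2 (- (sqrt (- 2 * \<sigma>\<^sup>2 * ln \<rho>) *\<^sub>R cis \<phi>))))"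
      by (rule integral_offspring_law_box_muller[OF \<sigma>]) (auto simp: v0 v1 mult_le_one)
    also have "\<dots> = X_term \<alpha> \<beta> r0 \<sigma> \<theta>"
    proof -
      have "receiver r0 \<theta> 1 = r0 * cis 0" "receiver r0 \<theta> 2 = r0 * cis \<theta>"
        by (simp_all add: receiver_def)
      then show ?thesis
        unfolding X_term_def by (simp only: v_polar)
    qed
    finally show ?thesis .
  qed
  \<comment> \<open>\<open>h k z\<close> is the success factor at receiver \<open>k\<close> of one
    offspring point at \<open>z\<close>, averaged over its access.\<close>
  define h where "h k z = 1 - p + p * u k z" for k z
  have h [measurable]: "h k \<in> borel_measurable borel" for k unfolding h_def by measurable
  have h0: "0 \<le> h k z" for k z
    unfolding h_def using p0 p1 u0 by simp
  have h1: "h k z \<le> 1" for k z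
    unfolding h_def using p0 u1[of k z] by (simp add: mult_left_le)
  have hh: "(\<lambda>z. h 1 z * h 2 z) \<in> borel_measurable borel"
    and hh0: "0 \<le> h 1 z * h 2 z" and hh1: "h 1 z * h 2 z \<le> 1" for z
    using h0 h1 by (auto intro: mult_le_one)
  have K1: "(\<integral>z. h k z \<partial>?O) = 1 - p + p * V_term \<alpha> \<beta> \<nu> (\<sigma> / r0)" for k
    unfolding h_def using int_u[of k] V[of k] O.prob_space by simp
  have K2: "(\<integral>z. h 1 z * h 2 z \<partial>?O) = D_term \<alpha> \<beta> p r0 \<nu> \<sigma> \<theta>"
  proof -
    \<comment> \<open>Both linear terms have the same mean \<open>V_term\<close>, since the distance
      law is the same at either receiver; this yields the coefficient
      \<open>2 * (1 - p) * p\<close>.\<close>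
    have "(\<integral>z. h 1 z * h 2 z \<partial>?O)
       = (\<integral>z. (1 - p)\<^sup>2 + (1 - p) * p * u 1 z + (1 - p) * p * u 2 z + p\<^sup>2 * (u 1 z * u 2 z) \<partial>?O)"
      by (intro Bochner_Integration.integral_cong) (auto simp: h_def algebra_simps power2_eq_square)
    also have "\<dots> = (1 - p)\<^sup>2 + (1 - p) * p * (\<integral>z. u 1 z \<partial>?O) + (1 - p) * p * (\<integral>z. u 2 z \<partial>?O)
        + p\<^sup>2 * (\<integral>z. u 1 z * u 2 z \<partial>?O)"
      using int_u int_uu O.prob_space by simp
    finally show ?thesis unfolding V X D_term_def by (simp add: algebra_simps)
  qed
  define A where "A g = (\<lambda>(m :: nat, X :: nat \<Rightarrow> complex). \<Prod>i = 1..m. g (X i))" for g :: "complex \<Rightarrow> real"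
  define e where "e = exp (- \<beta> / SNR)"
  have out: "cluster_outage \<alpha> \<beta> SNR a r0 \<theta> k = (\<lambda>\<omega>. 1 - e * A (h k) \<omega>)" for k
    using p0 p1 a by (auto simp: cluster_outage_def outage_prob_eq[OF \<beta> SNR] rel_dist_def e_def A_def h_def u_def q_def)
  have A_mult: "A (h 1) \<omega> * A (h 2) \<omega> = A (\<lambda>z. h 1 z * h 2 z) \<omega>" for \<omega>
    by (simp add: A_def prod.distrib split: prod.split)
  have int_A: "integrable ?T (A (h k))" for k
    unfolding A_def by (rule thomas_cluster_prod_integrable[OF \<sigma> h h0 h1])
  have int_AA: "integrable ?T (A (\<lambda>z. h 1 z * h 2 z))"
    unfolding A_def by (rule thomas_cluster_prod_integrable[OF \<sigma> hh hh0 hh1])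
  define B where "B = exp (- lambda' * (1 - (1 - p + p * V_term \<alpha> \<beta> \<nu> (\<sigma> / r0))))"
  \<comment> \<open>The mean \<open>B\<close> does not depend on \<open>k\<close>: the two outage
    probabilities are equal in expectation, so \<open>j\<close> may be either receiver.\<close>
  have EA: "integral\<^sup>L ?T (A (h k)) = B" for k
    unfolding A_def B_def by (subst thomas_cluster_prod_integral[OF \<mu> \<sigma> h h0 h1]) (simp add: K1)
  \<comment> \<open>The exponent carries \<open>1 - D_term\<close>, as the generating function
    dictates. For \<open>p = 0\<close> the mean of \<open>h 1 z * h 2 z\<close> is 1 and the
    exponent vanishes, as it must without interference.\<close>
  have EAA: "integral\<^sup>L ?T (A (\<lambda>z. h 1 z * h 2 z)) = exp (- lambda' * (1 - D_term \<alpha> \<beta> p r0 \<nu> \<sigma> \<theta>))"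
    unfolding A_def by (subst thomas_cluster_prod_integral[OF \<mu> \<sigma> hh hh0 hh1]) (simp only: K2)
  have "(\<integral>\<omega>. cluster_outage \<alpha> \<beta> SNR a r0 \<theta> 1 \<omega> * cluster_outage \<alpha> \<beta> SNR a r0 \<theta> 2 \<omega> \<partial>?T)
     = (\<integral>\<omega>. 1 - e * A (h 1) \<omega> - e * A (h 2) \<omega> + e\<^sup>2 * A (\<lambda>z. h 1 z * h 2 z) \<omega> \<partial>?T)"
    unfolding out A_mult[symmetric]
    by (intro Bochner_Integration.integral_cong) (auto simp: algebra_simps power2_eq_square)
  also have "\<dots> = 1 - e * B - e * B + e\<^sup>2 * exp (- lambda' * (1 - D_term \<alpha> \<beta> p r0 \<nu> \<sigma> \<theta>))"
    using int_A int_AA EAA T.prob_space by (simp add: EA)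
  also have "e\<^sup>2 * exp (- lambda' * (1 - D_term \<alpha> \<beta> p r0 \<nu> \<sigma> \<theta>))
     = exp (- 2 * \<beta> / SNR - lambda' * (1 - D_term \<alpha> \<beta> p r0 \<nu> \<sigma> \<theta>))"
    by (simp add: e_def power2_eq_square exp_add[symmetric])
  finally have "(\<integral>\<omega>. cluster_outage \<alpha> \<beta> SNR a r0 \<theta> 1 \<omega> * cluster_outage \<alpha> \<beta> SNR a r0 \<theta> 2 \<omega> \<partial>?T)
     = 1 - e * B - e * B + exp (- 2 * \<beta> / SNR - lambda' * (1 - D_term \<alpha> \<beta> p r0 \<nu> \<sigma> \<theta>))" .
  \<comment> \<open>The two linear terms combine as
    \<open>1 - 2 * e * B = 2 * (1 - e * B) - 1\<close>.\<close>
  moreover have "(\<integral>\<omega>. cluster_outage \<alpha> \<beta> SNR a r0 \<theta> j \<omega> \<partial>?T) = 1 - e * B"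
    unfolding out using int_A T.prob_space by (simp add: EA)
  ultimately show ?thesis by simp
qed

end
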